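(* For any tame $\ell_c$-group $G$, the Fell topology on $\widehat{G}$ is $T_1$.
   Context: An $\ell$-group is a Hausdorff, locally compact, totally disconnected topological group. An $\ell_c$-group is an $\ell$-group which is a filtered union of its compact open subgroups (every element lies in a compact open subgroup, and any two compact open subgroups are contained in a third). A complex representation $(\pi,V)$ of an $\ell$-group $G$ is smooth if every vector of $V$ has open stabilizer in $G$; it is admissible if in addition $V^K$ is finite-dimensional for every compact open subgroup $K \subset G$. An $\ell$-group is tame if all its irreducible smooth representations are admissible. $\widehat{G}$ is the set of isomorphism classes of irreducible smooth representations of $G$. Fell topology on $\widehat{G}$: for a smooth representation $V$ let $V^{\vee}$ be its smooth dual (the vectors of the linear dual $V^*$ with open stabilizer). For $(\pi,V)\in\widehat{G}$, vectors $v_1,\dots,v_n\in V$, $\xi_1,\dots,\xi_n\in V^{\vee}$, a compact subset $B\subset G$ and $\epsilon>0$, let $\mathscr{U}(\pi,v_j,\xi_j,B,\epsilon)$ be the set of $(\rho,X)\in\widehat{G}$ for which there exist $w_1,\dots,w_n\in X$ and $\zeta_1,\dots,\zeta_n\in X^{\vee}$ with $|\langle \xi_j,\pi(g)v_j\rangle-\langle\zeta_j,\rho(g)w_j\rangle|<\epsilon$ for all $1\le j\le n$ and $g\in B$. These sets form a basis of neighborhoods of $\pi$ in the Fell topology. *)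

theory Defs
  imports "HOL-Analysis.Analysis" "HOL-Algebra.Coset" "HOL-Library.Function_Algebras"
begin

section \<open>Topological groups\<close>

definition topological_group :: "('a, 'b) monoid_scheme \<Rightarrow> 'a topology \<Rightarrow> bool" where
  "topological_group G T \<longleftrightarrow>
     group G \<and> topspace T = carrier G \<and>
     continuous_map (prod_topology T T) T (\<lambda>(x, y). x \<otimes>\<^bsub>G\<^esub> y) \<and>
     continuous_map T T (\<lambda>x. inv\<^bsub>G\<^esub> x)"

definition totally_disconnected_space :: "'a topology \<Rightarrow> bool" where
  "totally_disconnected_space T \<longleftrightarrow> (\<forall>S. connectedin T S \<longrightarrow> (\<exists>x. S \<subseteq> {x}))"

definition l_group :: "('a, 'b) monoid_scheme \<Rightarrow> 'a topology \<Rightarrow> bool" where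
  "l_group G T \<longleftrightarrow>
     topological_group G T \<and> Hausdorff_space T \<and> locally_compact_space T \<and>
     totally_disconnected_space T"

definition compact_open_subgroup :: "('a, 'b) monoid_scheme \<Rightarrow> 'a topology \<Rightarrow> 'a set \<Rightarrow> bool" where
  "compact_open_subgroup G T K \<longleftrightarrow> subgroup K G \<and> compactin T K \<and> openin T K"

definition lc_group :: "('a, 'b) monoid_scheme \<Rightarrow> 'a topology \<Rightarrow> bool" where
  "lc_group G T \<longleftrightarrow>
     l_group G T \<and>
     (\<forall>g \<in> carrier G. \<exists>K. compact_open_subgroup G T K \<and> g \<in> K) \<and>
     (\<forall>K L. compact_open_subgroup G T K \<longrightarrow> compact_open_subgroup G T L \<longrightarrow>
        (\<exists>M. compact_open_subgroup G T M \<and> K \<subseteq> M \<and> L \<subseteq> M))"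

section \<open>Smooth representations\<close>

text \<open>The underlying space of a representation is a linear subspace of an ambient complex vector
  space, which is a whole type \<open>'v\<close> with scalar multiplication \<open>s\<close>. The action is only relevant
  for group elements in the carrier and vectors in the space.\<close>

record ('a, 'v) rep =
  rep_space :: "'v set"
  action :: "'a \<Rightarrow> 'v \<Rightarrow> 'v"

definition linear_on ::
  "(complex \<Rightarrow> 'v \<Rightarrow> 'v::ab_group_add) \<Rightarrow> (complex \<Rightarrow> 'w \<Rightarrow> 'w::ab_group_add) \<Rightarrow> 'v set \<Rightarrow> ('v \<Rightarrow> 'w) \<Rightarrow> bool"
  where
  "linear_on s t V f \<longleftrightarrow>
     (\<forall>x\<in>V. \<forall>y\<in>V. f (x + y) = f x + f y) \<and> (\<forall>c. \<forall>x\<in>V. f (s c x) = t c (f x))"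

definition representation ::
  "('a, 'b) monoid_scheme \<Rightarrow> (complex \<Rightarrow> 'v \<Rightarrow> 'v::ab_group_add) \<Rightarrow> ('a, 'v) rep \<Rightarrow> bool" where
  "representation G s r \<longleftrightarrow>
     vector_space s \<and> module.subspace s (rep_space r) \<and>
     (\<forall>g \<in> carrier G. action r g \<in> rep_space r \<rightarrow> rep_space r \<and>
        linear_on s s (rep_space r) (action r g)) \<and>
     (\<forall>v \<in> rep_space r. action r \<one>\<^bsub>G\<^esub> v = v) \<and>
     (\<forall>g \<in> carrier G. \<forall>h \<in> carrier G. \<forall>v \<in> rep_space r.
        action r (g \<otimes>\<^bsub>G\<^esub> h) v = action r g (action r h v))"

definition smooth_rep ::
  "('a, 'b) monoid_scheme \<Rightarrow> 'a topology \<Rightarrow> (complex \<Rightarrow> 'v \<Rightarrow> 'v::ab_group_add) \<Rightarrow> ('a, 'v) rep \<Rightarrow> bool"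
  where
  "smooth_rep G T s r \<longleftrightarrow>
     representation G s r \<and>
     (\<forall>v \<in> rep_space r. openin T {g \<in> carrier G. action r g v = v})"

definition fixed_vectors :: "('a, 'v) rep \<Rightarrow> 'a set \<Rightarrow> 'v set" where
  "fixed_vectors r K = {v \<in> rep_space r. \<forall>k \<in> K. action r k v = v}"

definition finite_dimensional :: "(complex \<Rightarrow> 'v \<Rightarrow> 'v::ab_group_add) \<Rightarrow> 'v set \<Rightarrow> bool" where
  "finite_dimensional s V \<longleftrightarrow> (\<exists>B. finite B \<and> module.span s B = V)"

definition admissible_rep ::
  "('a, 'b) monoid_scheme \<Rightarrow> 'a topology \<Rightarrow> (complex \<Rightarrow> 'v \<Rightarrow> 'v::ab_group_add) \<Rightarrow> ('a, 'v) rep \<Rightarrow> bool"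
  where
  "admissible_rep G T s r \<longleftrightarrow>
     smooth_rep G T s r \<and>
     (\<forall>K. compact_open_subgroup G T K \<longrightarrow> finite_dimensional s (fixed_vectors r K))"

definition irreducible_rep ::
  "('a, 'b) monoid_scheme \<Rightarrow> (complex \<Rightarrow> 'v \<Rightarrow> 'v::ab_group_add) \<Rightarrow> ('a, 'v) rep \<Rightarrow> bool" where
  "irreducible_rep G s r \<longleftrightarrow>
     representation G s r \<and> rep_space r \<noteq> {0} \<and>
     (\<forall>W. module.subspace s W \<and> W \<subseteq> rep_space r \<and>
          (\<forall>g \<in> carrier G. \<forall>w \<in> W. action r g w \<in> W) \<longrightarrow> W = {0} \<or> W = rep_space r)"

definition rep_iso ::
  "('a, 'b) monoid_scheme \<Rightarrow> (complex \<Rightarrow> 'v \<Rightarrow> 'v::ab_group_add) \<Rightarrow> (complex \<Rightarrow> 'w \<Rightarrow> 'w::ab_group_add) \<Rightarrow>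
   ('a, 'v) rep \<Rightarrow> ('a, 'w) rep \<Rightarrow> ('v \<Rightarrow> 'w) \<Rightarrow> bool" where
  "rep_iso G s t r q \<phi> \<longleftrightarrow>
     bij_betw \<phi> (rep_space r) (rep_space q) \<and> linear_on s t (rep_space r) \<phi> \<and>
     (\<forall>g \<in> carrier G. \<forall>v \<in> rep_space r. \<phi> (action r g v) = action q g (\<phi> v))"

text \<open>Functionals are considered through their values on the space of the representation only;
  their values elsewhere are arbitrary.\<close>

definition smooth_dual ::
  "('a, 'b) monoid_scheme \<Rightarrow> 'a topology \<Rightarrow> (complex \<Rightarrow> 'v \<Rightarrow> 'v::ab_group_add) \<Rightarrow> ('a, 'v) rep \<Rightarrow>
   ('v \<Rightarrow> complex) set" where
  "smooth_dual G T s r =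
     {\<xi>. linear_on s (*) (rep_space r) \<xi> \<and>
         openin T {g \<in> carrier G. \<forall>v \<in> rep_space r. \<xi> (action r (inv\<^bsub>G\<^esub> g) v) = \<xi> v}}"

section \<open>The dual space and its Fell topology\<close>

text \<open>Isomorphism classes must be formed over a fixed ambient type. Every irreducible smooth
  representation of \<open>G\<close>, over whatever type, is isomorphic to one whose space consists of functions
  \<open>'a \<Rightarrow> complex\<close> (see \<open>irreducible_smooth_model\<close> below), so no class is lost by taking these; likewise \<open>tame\<close>
  gives admissibility of irreducible smooth representations over any type (\<open>tame_admissible\<close>).\<close>

definition fun_scale :: "complex \<Rightarrow> ('a \<Rightarrow> complex) \<Rightarrow> 'a \<Rightarrow> complex" where
  "fun_scale c f = (\<lambda>x. c * f x)"

definition irreps ::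
  "('a, 'b) monoid_scheme \<Rightarrow> 'a topology \<Rightarrow> ('a, 'a \<Rightarrow> complex) rep set" where
  "irreps G T = {r. smooth_rep G T fun_scale r \<and> irreducible_rep G fun_scale r}"

definition tame :: "('a, 'b) monoid_scheme \<Rightarrow> 'a topology \<Rightarrow> bool" where
  "tame G T \<longleftrightarrow> (\<forall>r \<in> irreps G T. admissible_rep G T fun_scale r)"

definition iso_rel ::
  "('a, 'b) monoid_scheme \<Rightarrow> 'a topology \<Rightarrow> ('a, 'a \<Rightarrow> complex) rep rel" where
  "iso_rel G T = {(r, q). r \<in> irreps G T \<and> q \<in> irreps G T \<and> (\<exists>\<phi>. rep_iso G fun_scale fun_scale r q \<phi>)}"

definition smooth_irr_classes ::
  "('a, 'b) monoid_scheme \<Rightarrow> 'a topology \<Rightarrow> ('a, 'a \<Rightarrow> complex) rep set set" where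
  "smooth_irr_classes G T = irreps G T // iso_rel G T"

definition fell_data ::
  "('a, 'b) monoid_scheme \<Rightarrow> 'a topology \<Rightarrow> ('a, 'a \<Rightarrow> complex) rep \<Rightarrow>
   nat \<Rightarrow> (nat \<Rightarrow> 'a \<Rightarrow> complex) \<Rightarrow> (nat \<Rightarrow> ('a \<Rightarrow> complex) \<Rightarrow> complex) \<Rightarrow> bool" where
  "fell_data G T r n v \<xi> \<longleftrightarrow> (\<forall>j<n. v j \<in> rep_space r \<and> \<xi> j \<in> smooth_dual G T fun_scale r)"

definition fell_nbhd ::
  "('a, 'b) monoid_scheme \<Rightarrow> 'a topology \<Rightarrow> ('a, 'a \<Rightarrow> complex) rep \<Rightarrow>
   nat \<Rightarrow> (nat \<Rightarrow> 'a \<Rightarrow> complex) \<Rightarrow> (nat \<Rightarrow> ('a \<Rightarrow> complex) \<Rightarrow> complex) \<Rightarrow> 'a set \<Rightarrow> real \<Rightarrow>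
   ('a, 'a \<Rightarrow> complex) rep set set" where
  "fell_nbhd G T r n v \<xi> B \<epsilon> =
     {c \<in> smooth_irr_classes G T. \<exists>q \<in> c. \<exists>w \<zeta>. fell_data G T q n w \<zeta> \<and>
        (\<forall>j<n. \<forall>g\<in>B. cmod (\<xi> j (action r g (v j)) - \<zeta> j (action q g (w j))) < \<epsilon>)}"

definition fell_open ::
  "('a, 'b) monoid_scheme \<Rightarrow> 'a topology \<Rightarrow> ('a, 'a \<Rightarrow> complex) rep set set \<Rightarrow> bool" where
  "fell_open G T U \<longleftrightarrow>
     U \<subseteq> smooth_irr_classes G T \<and>
     (\<forall>c \<in> U. \<forall>r \<in> c. \<exists>n v \<xi> B \<epsilon>. fell_data G T r n v \<xi> \<and> compactin T B \<and> 0 < \<epsilon> \<and>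
        fell_nbhd G T r n v \<xi> B \<epsilon> \<subseteq> U)"

text \<open>The lemmas \<open>openin_fell_topology\<close>, \<open>topspace_fell_topology\<close>, \<open>fell_nbhd_self\<close> and
  \<open>openin_fell_nbhd\<close> below show that this is a topology on the set of isomorphism classes for which
  the sets \<open>fell_nbhd\<close> of a class are a basis of its (open) neighbourhoods.\<close>

definition fell_topology ::
  "('a, 'b) monoid_scheme \<Rightarrow> 'a topology \<Rightarrow> ('a, 'a \<Rightarrow> complex) rep set topology" where
  "fell_topology G T = topology (fell_open G T)"

subsection \<open>The Fell topology is a topology\<close>

lemma fell_nbhd_subset: "fell_nbhd G T r n v \<xi> B \<epsilon> \<subseteq> smooth_irr_classes G T"
  by (auto simp: fell_nbhd_def)

lemma fell_openE:
  assumes "fell_open G T U" "c \<in> U" "r \<in> c"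
  obtains n v \<xi> B \<epsilon> where "fell_data G T r n v \<xi>" "compactin T B" "0 < \<epsilon>"
      "fell_nbhd G T r n v \<xi> B \<epsilon> \<subseteq> U"
proof -
  have "\<exists>n v \<xi> B \<epsilon>. fell_data G T r n v \<xi> \<and> compactin T B \<and> 0 < \<epsilon> \<and>
        fell_nbhd G T r n v \<xi> B \<epsilon> \<subseteq> U"
    using assms(1)[unfolded fell_open_def, THEN conjunct2, rule_format, OF assms(2,3)] .
  then show ?thesis using that by (elim exE conjE)
qed

lemma fell_open_Int:
  assumes "fell_open G T U" "fell_open G T W"
  shows "fell_open G T (U \<inter> W)"
  unfolding fell_open_def
proof (intro conjI ballI)
  show "U \<inter> W \<subseteq> smooth_irr_classes G T" using assms by (auto simp: fell_open_def)
  fix c r assume c: "c \<in> U \<inter> W" and r: "r \<in> c"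
  note cU = IntD1[OF c] and cW = IntD2[OF c]
  obtain n v \<xi> B \<epsilon> where 1: "fell_data G T r n v \<xi>" "compactin T B" "0 < \<epsilon>"
      "fell_nbhd G T r n v \<xi> B \<epsilon> \<subseteq> U"
    by (rule fell_openE[OF assms(1) cU r])
  obtain n' v' \<xi>' B' \<epsilon>' where 2: "fell_data G T r n' v' \<xi>'" "compactin T B'" "0 < \<epsilon>'"
      "fell_nbhd G T r n' v' \<xi>' B' \<epsilon>' \<subseteq> W"
    by (rule fell_openE[OF assms(2) cW r])
  define v2 where "v2 j = (if j < n then v j else v' (j - n))" for j
  define \<xi>2 where "\<xi>2 j = (if j < n then \<xi> j else \<xi>' (j - n))" for j
  have d: "fell_data G T r (n + n') v2 \<xi>2"
    using 1(1) 2(1) by (auto simp: fell_data_def v2_def \<xi>2_def)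
  have "fell_nbhd G T r (n + n') v2 \<xi>2 (B \<union> B') (min \<epsilon> \<epsilon>') \<subseteq> fell_nbhd G T r n v \<xi> B \<epsilon>"
  proof
    fix x assume "x \<in> fell_nbhd G T r (n + n') v2 \<xi>2 (B \<union> B') (min \<epsilon> \<epsilon>')"
    then obtain q w \<zeta> where x: "x \<in> smooth_irr_classes G T" "q \<in> x" "fell_data G T q (n + n') w \<zeta>"
      and *: "\<forall>j<n+n'. \<forall>g\<in>B \<union> B'. cmod (\<xi>2 j (action r g (v2 j)) - \<zeta> j (action q g (w j))) < min \<epsilon> \<epsilon>'"
      unfolding fell_nbhd_def by blast
    have "fell_data G T q n w \<zeta>" using x(3) by (auto simp: fell_data_def)
    moreover have "cmod (\<xi> j (action r g (v j)) - \<zeta> j (action q g (w j))) < \<epsilon>" if "j < n" "g \<in> B" for j g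
      using *[rule_format, of j g] that by (simp add: v2_def \<xi>2_def)
    ultimately show "x \<in> fell_nbhd G T r n v \<xi> B \<epsilon>"
      using x(1,2) unfolding fell_nbhd_def by blast
  qed
  moreover have "fell_nbhd G T r (n + n') v2 \<xi>2 (B \<union> B') (min \<epsilon> \<epsilon>') \<subseteq> fell_nbhd G T r n' v' \<xi>' B' \<epsilon>'"
  proof
    fix x assume "x \<in> fell_nbhd G T r (n + n') v2 \<xi>2 (B \<union> B') (min \<epsilon> \<epsilon>')"
    then obtain q w \<zeta> where x: "x \<in> smooth_irr_classes G T" "q \<in> x" "fell_data G T q (n + n') w \<zeta>"
      and *: "\<forall>j<n+n'. \<forall>g\<in>B \<union> B'. cmod (\<xi>2 j (action r g (v2 j)) - \<zeta> j (action q g (w j))) < min \<epsilon> \<epsilon>'"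
      unfolding fell_nbhd_def by blast
    have "fell_data G T q n' (\<lambda>j. w (n + j)) (\<lambda>j. \<zeta> (n + j))" using x(3) by (auto simp: fell_data_def)
    moreover have "cmod (\<xi>' j (action r g (v' j)) - \<zeta> (n + j) (action q g (w (n + j)))) < \<epsilon>'"
      if "j < n'" "g \<in> B'" for j g
      using *[rule_format, of "n + j" g] that by (simp add: v2_def \<xi>2_def)
    ultimately show "x \<in> fell_nbhd G T r n' v' \<xi>' B' \<epsilon>'"
      using x(1,2) unfolding fell_nbhd_def by blast
  qed
  ultimately have "fell_nbhd G T r (n + n') v2 \<xi>2 (B \<union> B') (min \<epsilon> \<epsilon>') \<subseteq> U \<inter> W"
    using 1(4) 2(4) by (meson Int_greatest subset_trans)
  moreover have "compactin T (B \<union> B')" using 1(2) 2(2) by (rule compactin_Un)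
  moreover have "0 < min \<epsilon> \<epsilon>'" using 1(3) 2(3) by simp
  ultimately show "\<exists>n v \<xi> B \<epsilon>. fell_data G T r n v \<xi> \<and> compactin T B \<and> 0 < \<epsilon> \<and>
        fell_nbhd G T r n v \<xi> B \<epsilon> \<subseteq> U \<inter> W"
    using d by (intro exI conjI)
qed

lemma istopology_fell_open: "istopology (fell_open G T)"
  unfolding istopology_def
proof (intro conjI allI impI)
  fix \<K> assume *: "\<forall>K\<in>\<K>. fell_open G T K"
  show "fell_open G T (\<Union>\<K>)"
    unfolding fell_open_def
  proof (intro conjI ballI)
    show "\<Union>\<K> \<subseteq> smooth_irr_classes G T" using * by (auto simp: fell_open_def)
    fix c r assume "c \<in> \<Union>\<K>" "r \<in> c"
    then obtain K where K: "K \<in> \<K>" "c \<in> K" by blast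
    obtain n v \<xi> B \<epsilon> where 1: "fell_data G T r n v \<xi>" "compactin T B" "0 < \<epsilon>"
        "fell_nbhd G T r n v \<xi> B \<epsilon> \<subseteq> K"
      by (rule fell_openE[OF bspec[OF * K(1)] K(2) \<open>r \<in> c\<close>])
    have "fell_nbhd G T r n v \<xi> B \<epsilon> \<subseteq> \<Union>\<K>"
      using 1(4) K(1) by blast
    with 1(1-3) show "\<exists>n v \<xi> B \<epsilon>. fell_data G T r n v \<xi> \<and> compactin T B \<and> 0 < \<epsilon> \<and>
        fell_nbhd G T r n v \<xi> B \<epsilon> \<subseteq> \<Union>\<K>"
      by (intro exI conjI)
  qed
qed (rule fell_open_Int)

lemma openin_fell_topology: "openin (fell_topology G T) U \<longleftrightarrow> fell_open G T U"
  unfolding fell_topology_def by (simp only: topology_inverse'[OF istopology_fell_open])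

lemma topspace_fell_topology: "topspace (fell_topology G T) = smooth_irr_classes G T"
proof
  show "topspace (fell_topology G T) \<subseteq> smooth_irr_classes G T"
    using openin_topspace[of "fell_topology G T", unfolded openin_fell_topology]
    unfolding fell_open_def by (rule conjunct1)
  have "fell_data G T r 0 v \<xi> \<and> compactin T {} \<and> (0::real) < 1 \<and>
     fell_nbhd G T r 0 v \<xi> {} 1 \<subseteq> smooth_irr_classes G T" for r v \<xi>
    by (simp add: fell_data_def fell_nbhd_subset)
  then have "\<exists>n v \<xi> B \<epsilon>. fell_data G T r n v \<xi> \<and> compactin T B \<and> 0 < \<epsilon> \<and>
      fell_nbhd G T r n v \<xi> B \<epsilon> \<subseteq> smooth_irr_classes G T" for r
    by (intro exI)
  then have "fell_open G T (smooth_irr_classes G T)"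
    unfolding fell_open_def by simp
  then show "smooth_irr_classes G T \<subseteq> topspace (fell_topology G T)"
    by (simp add: openin_fell_topology openin_subset)
qed

lemma fell_nbhd_self:
  assumes "c \<in> smooth_irr_classes G T" "r \<in> c" "fell_data G T r n v \<xi>" "0 < \<epsilon>"
  shows "c \<in> fell_nbhd G T r n v \<xi> B \<epsilon>"
proof -
  have "\<forall>j<n. \<forall>g\<in>B. cmod (\<xi> j (action r g (v j)) - \<xi> j (action r g (v j))) < \<epsilon>"
    using assms(4) by simp
  then show ?thesis using assms unfolding fell_nbhd_def by blast
qed

subsection \<open>Transport along isomorphisms\<close>

lemma representation_space:
  assumes "representation G s r"
  shows "vector_space s" "module s" "module.subspace s (rep_space r)" "0 \<in> rep_space r"
    "\<And>x y. x \<in> rep_space r \<Longrightarrow> y \<in> rep_space r \<Longrightarrow> x + y \<in> rep_space r"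
    "\<And>c x. x \<in> rep_space r \<Longrightarrow> s c x \<in> rep_space r"
    "\<And>g x. g \<in> carrier G \<Longrightarrow> x \<in> rep_space r \<Longrightarrow> action r g x \<in> rep_space r"
proof -
  show 1: "vector_space s" "module.subspace s (rep_space r)"
    using assms by (auto simp: representation_def)
  show 2: "module s" using 1(1) by (simp add: module_iff_vector_space)
  show "0 \<in> rep_space r" "\<And>x y. x \<in> rep_space r \<Longrightarrow> y \<in> rep_space r \<Longrightarrow> x + y \<in> rep_space r"
    "\<And>c x. x \<in> rep_space r \<Longrightarrow> s c x \<in> rep_space r"
    using 1(2) module.subspace_def[OF 2] by auto
  show "\<And>g x. g \<in> carrier G \<Longrightarrow> x \<in> rep_space r \<Longrightarrow> action r g x \<in> rep_space r"
    using assms by (auto simp: representation_def)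
qed

lemma linear_on_zero:
  assumes "linear_on s t V f" "(0::'v::ab_group_add) \<in> V"
  shows "f 0 = (0::'w::ab_group_add)"
proof -
  have "f (0 + 0) = f 0 + f 0" using assms unfolding linear_on_def by blast
  then show ?thesis by simp
qed

lemma rep_iso_transport:
  fixes s :: "complex \<Rightarrow> 'v \<Rightarrow> 'v::ab_group_add" and t :: "complex \<Rightarrow> 'w \<Rightarrow> 'w::ab_group_add"
  assumes sm: "smooth_rep G T s r" and irr: "irreducible_rep G s r" and t: "vector_space t"
    and lin: "linear_on s t (rep_space r) \<phi>" and inj: "inj_on \<phi> (rep_space r)"
    and G: "group G"
  defines "q \<equiv> \<lparr>rep_space = \<phi> ` rep_space r,
                action = (\<lambda>g w. \<phi> (action r g (inv_into (rep_space r) \<phi> w)))\<rparr>"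
  shows "smooth_rep G T t q" "irreducible_rep G t q" "rep_iso G s t r q \<phi>"
proof -
  let ?V = "rep_space r"
  interpret G: group G by fact
  have r: "representation G s r" using sm by (simp add: smooth_rep_def)
  note V = representation_space[OF r]
  have mt: "module t" using t by (simp add: module_iff_vector_space)
  have add: "\<phi> (x + y) = \<phi> x + \<phi> y" if "x \<in> ?V" "y \<in> ?V" for x y
    using lin that by (simp add: linear_on_def)
  have sc: "\<phi> (s c x) = t c (\<phi> x)" if "x \<in> ?V" for x c
    using lin that by (simp add: linear_on_def)
  have z: "\<phi> 0 = 0" using lin V(4) by (rule linear_on_zero)
  have act: "action q g (\<phi> v) = \<phi> (action r g v)" if "v \<in> ?V" for g v
    using that inj by (simp add: q_def)
  have qV: "rep_space q = \<phi> ` ?V" by (simp add: q_def)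
  have subq: "module.subspace t (\<phi> ` W)" if "module.subspace s W" "W \<subseteq> ?V" for W
    unfolding module.subspace_def[OF mt]
  proof (intro conjI ballI allI)
    have W: "0 \<in> W" "\<And>x y. x \<in> W \<Longrightarrow> y \<in> W \<Longrightarrow> x + y \<in> W" "\<And>c x. x \<in> W \<Longrightarrow> s c x \<in> W"
      using that(1) module.subspace_def[OF V(2)] by auto
    show "0 \<in> \<phi> ` W" using W(1) z by (metis imageI)
    show "x + y \<in> \<phi> ` W" if "x \<in> \<phi> ` W" "y \<in> \<phi> ` W" for x y
      using that W(2) add \<open>W \<subseteq> ?V\<close> by (smt (verit, best) image_iff subsetD)
    show "t c x \<in> \<phi> ` W" if "x \<in> \<phi> ` W" for c x
      using that W(3) sc \<open>W \<subseteq> ?V\<close> by (smt (verit, best) image_iff subsetD)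
  qed
  have rlin: "action r g (x + y) = action r g x + action r g y" "action r g (s c x) = s c (action r g x)"
    if "g \<in> carrier G" "x \<in> ?V" "y \<in> ?V" for g x y c
    using r that by (auto simp: representation_def linear_on_def)
  have repq: "representation G t q"
    unfolding representation_def qV
  proof (intro conjI ballI)
    show "vector_space t" by fact
    show "module.subspace t (\<phi> ` ?V)" using subq V(3) by blast
    show "action q g \<in> \<phi> ` ?V \<rightarrow> \<phi> ` ?V" if "g \<in> carrier G" for g
      using act V(7)[OF that] by auto
    show "linear_on t t (\<phi> ` ?V) (action q g)" if g: "g \<in> carrier G" for g
      unfolding linear_on_def
    proof (intro conjI ballI allI)
      fix x y assume "x \<in> \<phi> ` ?V" "y \<in> \<phi> ` ?V"
      then obtain a b where "a \<in> ?V" "b \<in> ?V" "x = \<phi> a" "y = \<phi> b" by blast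
      then show "action q g (x + y) = action q g x + action q g y"
        using V(5,7) g by (simp add: act add[symmetric] rlin(1))
    next
      fix c x assume "x \<in> \<phi> ` ?V"
      then obtain a where "a \<in> ?V" "x = \<phi> a" by blast
      then show "action q g (t c x) = t c (action q g x)"
        using V(6,7) g by (simp add: act sc[symmetric] rlin(2))
    qed
    show "action q \<one>\<^bsub>G\<^esub> x = x" if "x \<in> \<phi> ` ?V" for x
      using that r act by (auto simp: representation_def)
    show "action q (g \<otimes>\<^bsub>G\<^esub> h) x = action q g (action q h x)"
      if "g \<in> carrier G" "h \<in> carrier G" "x \<in> \<phi> ` ?V" for g h x
    proof -
      obtain a where "a \<in> ?V" "x = \<phi> a" using \<open>x \<in> \<phi> ` ?V\<close> by blast
      moreover have "action r (g \<otimes>\<^bsub>G\<^esub> h) a = action r g (action r h a)"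
        using r that \<open>a \<in> ?V\<close> by (simp add: representation_def)
      ultimately show ?thesis using act V(7) that by simp
    qed
  qed
  have eqinj: "\<phi> x = \<phi> y \<longleftrightarrow> x = y" if "x \<in> ?V" "y \<in> ?V" for x y
    using inj that by (meson inj_on_eq_iff)
  show "smooth_rep G T t q"
    unfolding smooth_rep_def
  proof (intro conjI ballI)
    fix w assume "w \<in> rep_space q"
    then obtain v where v: "v \<in> ?V" "w = \<phi> v" using qV by blast
    have "{g \<in> carrier G. action q g w = w} = {g \<in> carrier G. action r g v = v}"
      using v act eqinj V(7) by auto
    then show "openin T {g \<in> carrier G. action q g w = w}"
      using sm v by (simp add: smooth_rep_def)
  qed (rule repq)
  show iso: "rep_iso G s t r q \<phi>"
    unfolding rep_iso_def using inj lin act by (auto simp: qV bij_betw_def)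
  show "irreducible_rep G t q"
    unfolding irreducible_rep_def
  proof (intro conjI allI impI)
    show "representation G t q" by fact
    obtain v where "v \<in> ?V" "v \<noteq> 0"
      using irr V(4) unfolding irreducible_rep_def by blast
    then have "\<phi> v \<noteq> 0" using eqinj[of v 0] V(4) z by simp
    then show "rep_space q \<noteq> {0}" using \<open>v \<in> ?V\<close> qV by blast
    fix W assume W: "module.subspace t W \<and> W \<subseteq> rep_space q \<and> (\<forall>g\<in>carrier G. \<forall>w\<in>W. action q g w \<in> W)"
    define U where "U = {v \<in> ?V. \<phi> v \<in> W}"
    have "module.subspace s U"
      unfolding module.subspace_def[OF V(2)]
      using W V(4-6) z add sc unfolding U_def module.subspace_def[OF mt] by auto
    moreover have "U \<subseteq> ?V" by (auto simp: U_def)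
    moreover have "\<forall>g\<in>carrier G. \<forall>w\<in>U. action r g w \<in> U"
      using W V(7) act unfolding U_def by fastforce
    ultimately have "U = {0} \<or> U = ?V"
      using irr unfolding irreducible_rep_def by blast
    moreover have "W = \<phi> ` U" using W qV by (auto simp: U_def)
    ultimately show "W = {0} \<or> W = rep_space q" using z qV by auto
  qed
qed

subsection \<open>Every irreducible smooth representation has a model on functions\<close>

lemma vector_space_fun_scale: "vector_space (fun_scale :: complex \<Rightarrow> ('a \<Rightarrow> complex) \<Rightarrow> _)"
  by unfold_locales (auto simp: fun_scale_def algebra_simps)

lemma exists_functional:
  fixes s :: "complex \<Rightarrow> 'v \<Rightarrow> 'v::ab_group_add"
  assumes "vector_space s" "v \<noteq> 0"
  shows "\<exists>\<xi>. linear_on s (*) UNIV \<xi> \<and> \<xi> v = (1::complex)"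
proof -
  interpret V: vector_space s by fact
  interpret P: vector_space_pair s "(*) :: complex \<Rightarrow> complex \<Rightarrow> complex"
    by unfold_locales (auto simp: algebra_simps)
  have ind: "V.independent {v}" using assms(2) by (simp add: V.dependent_single)
  define \<xi> where "\<xi> = P.construct {v} (\<lambda>_. 1)"
  have "Vector_Spaces.linear s (*) \<xi>" unfolding \<xi>_def using ind by (rule P.linear_construct)
  then have "linear_on s (*) UNIV \<xi>"
    by (auto simp: linear_on_def Vector_Spaces.linear_iff)
  moreover have "\<xi> v = 1" unfolding \<xi>_def using P.construct_basis[OF ind] by simp
  ultimately show ?thesis by blast
qed

theorem irreducible_smooth_model:
  fixes s :: "complex \<Rightarrow> 'v \<Rightarrow> 'v::ab_group_add" and r :: "('a, 'v) rep"
  assumes G: "group G" and sm: "smooth_rep G T s r" and irr: "irreducible_rep G s r"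
  shows "\<exists>q \<in> irreps G T. \<exists>\<phi>. rep_iso G s fun_scale r q \<phi>"
proof -
  let ?V = "rep_space r"
  interpret G: group G by fact
  have r: "representation G s r" using sm by (simp add: smooth_rep_def)
  note V = representation_space[OF r]
  interpret S: vector_space s by (rule V(1))
  obtain v0 where v0: "v0 \<in> ?V" "v0 \<noteq> 0"
    using irr V(4) unfolding irreducible_rep_def by blast
  obtain \<xi> where \<xi>: "linear_on s (*) UNIV \<xi>" "\<xi> v0 = (1::complex)"
    using exists_functional[OF V(1) v0(2)] by blast
  define \<phi> where "\<phi> v = (\<lambda>g. if g \<in> carrier G then \<xi> (action r g v) else 0)" for v
  have rlin: "action r g (x + y) = action r g x + action r g y" "action r g (s c x) = s c (action r g x)"
    if "g \<in> carrier G" "x \<in> ?V" "y \<in> ?V" for g x y c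
    using r that by (auto simp: representation_def linear_on_def)
  have lin: "linear_on s fun_scale ?V \<phi>"
    unfolding linear_on_def \<phi>_def fun_scale_def using \<xi>(1) rlin
    by (auto simp: linear_on_def fun_eq_iff)
  define U where "U = {v \<in> ?V. \<phi> v = 0}"
  have "S.subspace U"
    unfolding S.subspace_def U_def using V(4-6) lin linear_on_zero[OF lin V(4)]
    by (auto simp: linear_on_def fun_scale_def fun_eq_iff)
  moreover have "action r h u \<in> U" if "h \<in> carrier G" "u \<in> U" for h u
  proof -
    have u: "u \<in> ?V" "\<And>g. g \<in> carrier G \<Longrightarrow> \<xi> (action r g u) = 0"
      using that(2) by (auto simp: U_def \<phi>_def fun_eq_iff split: if_splits) 
    have "\<xi> (action r g (action r h u)) = 0" if "g \<in> carrier G" for g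
      using u(2)[of "g \<otimes>\<^bsub>G\<^esub> h"] r that \<open>h \<in> carrier G\<close> u(1) by (simp add: representation_def)
    then show ?thesis using V(7)[OF that(1) u(1)] by (auto simp: U_def \<phi>_def fun_eq_iff)
  qed
  ultimately have "U = {0} \<or> U = ?V"
    using irr unfolding irreducible_rep_def U_def by blast
  moreover have "v0 \<notin> U"
  proof -
    have "\<phi> v0 \<one>\<^bsub>G\<^esub> = 1" using \<xi>(2) r v0(1) by (simp add: \<phi>_def representation_def)
    then show ?thesis by (auto simp: U_def)
  qed
  ultimately have U0: "U = {0}" using v0(1) by blast
  have inj: "inj_on \<phi> ?V"
  proof (rule inj_onI)
    fix x y assume xy: "x \<in> ?V" "y \<in> ?V" "\<phi> x = \<phi> y"
    have m: "x - y \<in> ?V" using S.subspace_diff[OF V(3) xy(1,2)] .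
    have "\<phi> (x - y + y) = \<phi> (x - y) + \<phi> y"
      using lin m xy(2) unfolding linear_on_def by blast
    then have "\<phi> (x - y) + \<phi> y = 0 + \<phi> y"
      by (simp only: diff_add_cancel xy(3) add_0_left)
    then have "\<phi> (x - y) = 0" by (simp only: add_right_cancel)
    then have "x - y \<in> U" using m by (simp only: U_def mem_Collect_eq simp_thms)
    then show "x = y" using U0 by simp
  qed
  show ?thesis
    using rep_iso_transport[OF sm irr vector_space_fun_scale lin inj G]
    unfolding irreps_def by blast
qed

lemma admissible_transport:
  fixes s :: "complex \<Rightarrow> 'v \<Rightarrow> 'v::ab_group_add" and t :: "complex \<Rightarrow> 'w \<Rightarrow> 'w::ab_group_add"
  assumes sm: "smooth_rep G T s r" and iso: "rep_iso G s t r q \<phi>" and ad: "admissible_rep G T t q"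
  shows "admissible_rep G T s r"
  unfolding admissible_rep_def
proof (intro conjI allI impI)
  show "smooth_rep G T s r" by fact
  fix K assume K: "compact_open_subgroup G T K"
  let ?V = "rep_space r" and ?W = "rep_space q"
  have r: "representation G s r" using sm by (simp add: smooth_rep_def)
  have q: "representation G t q" using ad by (simp add: smooth_rep_def admissible_rep_def)
  note V = representation_space[OF r] note W = representation_space[OF q]
  interpret S: module s by (rule V(2))
  interpret R: module t by (rule W(2))
  have bij: "bij_betw \<phi> ?V ?W" and lin: "linear_on s t ?V \<phi>"
    and eq: "\<And>g v. g \<in> carrier G \<Longrightarrow> v \<in> ?V \<Longrightarrow> \<phi> (action r g v) = action q g (\<phi> v)"
    using iso by (auto simp: rep_iso_def)
  have KG: "K \<subseteq> carrier G" using K by (auto simp: compact_open_subgroup_def dest: subgroup.subset)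
  obtain B where B: "finite B" "R.span B = fixed_vectors q K"
    using ad K by (auto simp: admissible_rep_def finite_dimensional_def)
  define \<psi> where "\<psi> = inv_into ?V \<phi>"
  have \<psi>: "\<psi> w \<in> ?V" "\<phi> (\<psi> w) = w" if "w \<in> ?W" for w
    using bij that unfolding \<psi>_def
    by (auto simp: bij_betw_def inv_into_into f_inv_into_f)
  have \<psi>\<phi>: "\<psi> (\<phi> v) = v" if "v \<in> ?V" for v
    using bij that unfolding \<psi>_def by (simp add: bij_betw_def)
  have inj: "x = y" if "x \<in> ?V" "y \<in> ?V" "\<phi> x = \<phi> y" for x y
    using bij that by (metis \<psi>\<phi>)
  have fix_iff: "v \<in> fixed_vectors r K \<longleftrightarrow> \<phi> v \<in> fixed_vectors q K" if "v \<in> ?V" for v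
  proof -
    have "\<phi> v \<in> ?W" using bij that by (auto simp: bij_betw_def)
    moreover have "action r k v = v \<longleftrightarrow> action q k (\<phi> v) = \<phi> v" if "k \<in> K" for k
      using KG that \<open>v \<in> ?V\<close> V(7) eq inj by (metis subsetD)
    ultimately show ?thesis using that by (auto simp: fixed_vectors_def)
  qed
  have BW: "R.span B \<subseteq> ?W" using B(2) by (auto simp: fixed_vectors_def)
  have Bsub: "B \<subseteq> R.span B" by (rule R.span_superset)
  have subfix: "S.subspace (fixed_vectors r K)"
  proof -
    have "action r k (x + y) = action r k x + action r k y" "action r k (s c x) = s c (action r k x)"
      "action r k 0 = 0"
      if "k \<in> K" "x \<in> ?V" "y \<in> ?V" for k x y c
      using r that KG V(4) linear_on_zero[of s s ?V "action r k"]
      by (auto simp: representation_def linear_on_def)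
    then show ?thesis unfolding S.subspace_def fixed_vectors_def using V(4-6) by auto
  qed
  have "S.span (\<psi> ` B) = fixed_vectors r K"
  proof
    show "S.span (\<psi> ` B) \<subseteq> fixed_vectors r K"
    proof (rule S.span_minimal[OF _ subfix])
      show "\<psi> ` B \<subseteq> fixed_vectors r K"
      proof
        fix x assume "x \<in> \<psi> ` B"
        then obtain b where b: "b \<in> B" "x = \<psi> b" by blast
        then have "b \<in> ?W" "b \<in> fixed_vectors q K" using Bsub BW B(2) by auto
        then show "x \<in> fixed_vectors r K" using fix_iff[OF \<psi>(1)] \<psi>(2) b(2) by simp
      qed
    qed
    show "fixed_vectors r K \<subseteq> S.span (\<psi> ` B)"
    proof
      fix v assume v: "v \<in> fixed_vectors r K"
      then have vV: "v \<in> ?V" by (simp add: fixed_vectors_def)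
      have "R.subspace {w \<in> ?W. \<psi> w \<in> S.span (\<psi> ` B)}"
        unfolding R.subspace_def
      proof (intro conjI ballI allI)
        have "\<psi> 0 = 0" using linear_on_zero[OF lin V(4)] \<psi>\<phi>[OF V(4)] by simp
        then show "0 \<in> {w \<in> ?W. \<psi> w \<in> S.span (\<psi> ` B)}" using W(4) S.span_zero by simp
        fix x y assume "x \<in> {w \<in> ?W. \<psi> w \<in> S.span (\<psi> ` B)}" "y \<in> {w \<in> ?W. \<psi> w \<in> S.span (\<psi> ` B)}"
        then have xy: "x \<in> ?W" "y \<in> ?W" "\<psi> x \<in> S.span (\<psi> ` B)" "\<psi> y \<in> S.span (\<psi> ` B)" by auto
        have "\<phi> (\<psi> x + \<psi> y) = x + y" using lin \<psi> xy(1,2) by (simp add: linear_on_def)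
        then have "\<psi> (x + y) = \<psi> x + \<psi> y" using \<psi>\<phi>[OF V(5)[OF \<psi>(1)[OF xy(1)] \<psi>(1)[OF xy(2)]]] by (simp only:)
        then show "x + y \<in> {w \<in> ?W. \<psi> w \<in> S.span (\<psi> ` B)}" using xy W(5) S.span_add by simp
      next
        fix c x assume "x \<in> {w \<in> ?W. \<psi> w \<in> S.span (\<psi> ` B)}"
        then have x: "x \<in> ?W" "\<psi> x \<in> S.span (\<psi> ` B)" by auto
        have "\<phi> (s c (\<psi> x)) = t c x" using lin \<psi> x(1) by (simp add: linear_on_def)
        then have "\<psi> (t c x) = s c (\<psi> x)" using \<psi>\<phi>[OF V(6)[OF \<psi>(1)]] x(1) by metis
        then show "t c x \<in> {w \<in> ?W. \<psi> w \<in> S.span (\<psi> ` B)}" using x W(6) S.span_scale by simp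
      qed
      moreover have "B \<subseteq> {w \<in> ?W. \<psi> w \<in> S.span (\<psi> ` B)}"
        using Bsub BW S.span_base by blast
      ultimately have "R.span B \<subseteq> {w \<in> ?W. \<psi> w \<in> S.span (\<psi> ` B)}"
        by (simp add: R.span_minimal)
      then show "v \<in> S.span (\<psi> ` B)"
        using fix_iff[OF vV] v B(2) \<psi>\<phi>[OF vV] by auto
    qed
  qed
  then show "finite_dimensional s (fixed_vectors r K)"
    unfolding finite_dimensional_def using B(1) by blast
qed

corollary tame_admissible:
  fixes s :: "complex \<Rightarrow> 'v \<Rightarrow> 'v::ab_group_add" and r :: "('a, 'v) rep"
  assumes "group G" "tame G T" "smooth_rep G T s r" "irreducible_rep G s r"
  shows "admissible_rep G T s r"
  using irreducible_smooth_model[OF assms(1,3,4)] admissible_transport[OF assms(3)] assms(2)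
  unfolding tame_def by blast

subsection \<open>The basic neighbourhoods are open\<close>

lemma rep_iso_refl: "rep_iso G s s r r id"
  by (simp add: rep_iso_def linear_on_def)

lemma rep_iso_trans:
  assumes "rep_iso G s t r q \<phi>" "rep_iso G t u q p \<psi>"
  shows "rep_iso G s u r p (\<psi> \<circ> \<phi>)"
proof -
  have "\<phi> v \<in> rep_space q" if "v \<in> rep_space r" for v
    using assms(1) that by (auto simp: rep_iso_def bij_betw_def)
  then show ?thesis
    using assms bij_betw_trans[of \<phi> "rep_space r" "rep_space q" \<psi> "rep_space p"]
    by (auto simp: rep_iso_def linear_on_def)
qed

lemma rep_iso_inv:
  assumes iso: "rep_iso G s t r q \<phi>" and r: "representation G s r"
  shows "rep_iso G t s q r (inv_into (rep_space r) \<phi>)"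
proof -
  let ?V = "rep_space r" and ?W = "rep_space q" and ?\<psi> = "inv_into (rep_space r) \<phi>"
  note V = representation_space[OF r]
  have bij: "bij_betw \<phi> ?V ?W" and lin: "linear_on s t ?V \<phi>"
    and eq: "\<And>g v. g \<in> carrier G \<Longrightarrow> v \<in> ?V \<Longrightarrow> \<phi> (action r g v) = action q g (\<phi> v)"
    using iso by (auto simp: rep_iso_def)
  have \<psi>: "?\<psi> w \<in> ?V" "\<phi> (?\<psi> w) = w" if "w \<in> ?W" for w
    using bij that by (auto simp: bij_betw_def inv_into_into f_inv_into_f)
  have \<psi>\<phi>: "?\<psi> (\<phi> v) = v" if "v \<in> ?V" for v
    using bij that by (simp add: bij_betw_def)
  have "?\<psi> (x + y) = ?\<psi> x + ?\<psi> y" if "x \<in> ?W" "y \<in> ?W" for x y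
  proof -
    have "\<phi> (?\<psi> x + ?\<psi> y) = x + y" using lin \<psi> that by (simp add: linear_on_def)
    then show ?thesis using \<psi>\<phi>[OF V(5)[OF \<psi>(1)[OF that(1)] \<psi>(1)[OF that(2)]]] by (simp only:)
  qed
  moreover have "?\<psi> (t c x) = s c (?\<psi> x)" if "x \<in> ?W" for c x
  proof -
    have "\<phi> (s c (?\<psi> x)) = t c x" using lin \<psi> that by (simp add: linear_on_def)
    then show ?thesis using \<psi>\<phi>[OF V(6)[OF \<psi>(1)]] that by metis
  qed
  moreover have "?\<psi> (action q g x) = action r g (?\<psi> x)" if "g \<in> carrier G" "x \<in> ?W" for g x
  proof -
    have "\<phi> (action r g (?\<psi> x)) = action q g x" using eq \<psi> that by simp
    then show ?thesis using \<psi>\<phi>[OF V(7)[OF _ \<psi>(1)]] that by metis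
  qed
  ultimately show ?thesis
    using bij_betw_inv_into[OF bij] by (simp add: rep_iso_def linear_on_def)
qed

lemma irreps_representation: "r \<in> irreps G T \<Longrightarrow> representation G fun_scale r"
  by (simp add: irreps_def smooth_rep_def)

lemma equiv_iso_rel: "equiv (irreps G T) (iso_rel G T)"
proof (rule equivI)
  show "iso_rel G T \<subseteq> irreps G T \<times> irreps G T" by (auto simp: iso_rel_def)
  show "refl_on (irreps G T) (iso_rel G T)"
    using rep_iso_refl by (auto simp: refl_on_def iso_rel_def)
  show "sym (iso_rel G T)"
    using rep_iso_inv irreps_representation unfolding sym_def iso_rel_def by blast
  show "trans (iso_rel G T)"
    using rep_iso_trans unfolding trans_def iso_rel_def by blast
qed

lemma smooth_orbit_finite:
  assumes TG: "topological_group G T" and sm: "smooth_rep G T s r"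
    and v: "v \<in> rep_space r" and B: "compactin T B"
  shows "finite ((\<lambda>g. action r g v) ` B)"
proof -
  interpret G: group G using TG by (simp add: topological_group_def)
  have top: "topspace T = carrier G" using TG by (simp add: topological_group_def)
  have r: "representation G s r" using sm by (simp add: smooth_rep_def)
  note V = representation_space[OF r]
  have BG: "B \<subseteq> carrier G" using compactin_subset_topspace[OF B] top by simp
  define S where "S = {g \<in> carrier G. action r g v = v}"
  define N where "N g = {h \<in> carrier G. action r h v = action r g v}" for g
  have mult: "action r (g \<otimes>\<^bsub>G\<^esub> h) v = action r g (action r h v)" if "g \<in> carrier G" "h \<in> carrier G" for g h
    using r that v by (simp add: representation_def)
  have one: "action r \<one>\<^bsub>G\<^esub> v = v" using r v by (simp add: representation_def)
  have op: "openin T (N g)" if g: "g \<in> carrier G" for g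
  proof -
    have mc: "continuous_map (prod_topology T T) T (\<lambda>(x, y). x \<otimes>\<^bsub>G\<^esub> y)"
      using TG by (simp add: topological_group_def)
    have "continuous_map T (prod_topology T T) (\<lambda>h. (inv\<^bsub>G\<^esub> g, h))"
      using g top by (simp add: continuous_map_pairedI)
    from continuous_map_compose[OF this mc]
    have "continuous_map T T (\<lambda>h. inv\<^bsub>G\<^esub> g \<otimes>\<^bsub>G\<^esub> h)" by (simp add: o_def)
    moreover have "openin T S" using sm v by (simp add: smooth_rep_def S_def)
    ultimately have "openin T {h \<in> topspace T. inv\<^bsub>G\<^esub> g \<otimes>\<^bsub>G\<^esub> h \<in> S}"
      by (rule openin_continuous_map_preimage)
    moreover have "{h \<in> topspace T. inv\<^bsub>G\<^esub> g \<otimes>\<^bsub>G\<^esub> h \<in> S} = N g"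
    proof -
      have "action r (inv\<^bsub>G\<^esub> g \<otimes>\<^bsub>G\<^esub> h) v = v \<longleftrightarrow> action r h v = action r g v" if h: "h \<in> carrier G" for h
      proof
        assume a: "action r (inv\<^bsub>G\<^esub> g \<otimes>\<^bsub>G\<^esub> h) v = v"
        have "action r h v = action r (g \<otimes>\<^bsub>G\<^esub> (inv\<^bsub>G\<^esub> g \<otimes>\<^bsub>G\<^esub> h)) v"
          using g h by (simp add: G.m_assoc[symmetric])
        also have "\<dots> = action r g v" using mult[OF g, of "inv\<^bsub>G\<^esub> g \<otimes>\<^bsub>G\<^esub> h"] a g h by simp
        finally show "action r h v = action r g v" .
      next
        assume a: "action r h v = action r g v"
        have "action r (inv\<^bsub>G\<^esub> g \<otimes>\<^bsub>G\<^esub> h) v = action r (inv\<^bsub>G\<^esub> g \<otimes>\<^bsub>G\<^esub> g) v"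
          using mult[of "inv\<^bsub>G\<^esub> g" h] mult[of "inv\<^bsub>G\<^esub> g" g] g h a by (simp only: G.inv_closed)
        then show "action r (inv\<^bsub>G\<^esub> g \<otimes>\<^bsub>G\<^esub> h) v = v" using g one by simp
      qed
      then show ?thesis using g top by (auto simp: N_def S_def)
    qed
    ultimately show ?thesis by simp
  qed
  have "B \<subseteq> \<Union>(N ` B)" using BG by (auto simp: N_def)
  moreover have "\<And>X. X \<in> N ` B \<Longrightarrow> openin T X" using op BG by auto
  ultimately obtain F where F: "finite F" "F \<subseteq> N ` B" "B \<subseteq> \<Union>F"
    using B unfolding compactin_def by meson
  obtain A where A: "finite A" "A \<subseteq> B" "F = N ` A" using F(1,2) by (meson finite_subset_image)
  have "(\<lambda>g. action r g v) ` B \<subseteq> (\<lambda>g. action r g v) ` A"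
    using F(3) A(3) by (auto simp: N_def)
  then show ?thesis using A(1) finite_surj by blast
qed

lemma fell_data_transport:
  assumes r: "r \<in> irreps G T" and d: "fell_data G T r n w \<zeta>"
    and iso: "rep_iso G fun_scale fun_scale r q \<phi>" and G: "group G"
  defines "\<psi> \<equiv> inv_into (rep_space r) \<phi>"
  shows "fell_data G T q n (\<lambda>j. \<phi> (w j)) (\<lambda>j. \<zeta> j \<circ> \<psi>)"
    "\<And>j g. j < n \<Longrightarrow> g \<in> carrier G \<Longrightarrow> (\<zeta> j \<circ> \<psi>) (action q g (\<phi> (w j))) = \<zeta> j (action r g (w j))"
proof -
  let ?V = "rep_space r" and ?W = "rep_space q"
  interpret G: group G by fact
  note rep = irreps_representation[OF r]
  note V = representation_space[OF rep]
  have bij: "bij_betw \<phi> ?V ?W"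
    and eq: "\<And>g v. g \<in> carrier G \<Longrightarrow> v \<in> ?V \<Longrightarrow> \<phi> (action r g v) = action q g (\<phi> v)"
    using iso by (auto simp: rep_iso_def)
  have iso': "rep_iso G fun_scale fun_scale q r \<psi>"
    unfolding \<psi>_def by (rule rep_iso_inv[OF iso rep])
  have \<psi>: "\<psi> x \<in> ?V" if "x \<in> ?W" for x
    using iso' that by (auto simp: rep_iso_def bij_betw_def)
  have \<psi>\<phi>: "\<psi> (\<phi> v) = v" if "v \<in> ?V" for v
    using bij that unfolding \<psi>_def by (simp add: bij_betw_def)
  have WV: "?W = \<phi> ` ?V" using bij by (simp add: bij_betw_def)
  have w: "w j \<in> ?V" "\<zeta> j \<in> smooth_dual G T fun_scale r" if "j < n" for j
    using d that by (auto simp: fell_data_def)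
  have "\<zeta> j \<circ> \<psi> \<in> smooth_dual G T fun_scale q" if j: "j < n" for j
    unfolding smooth_dual_def
  proof (intro CollectI conjI)
    show "linear_on fun_scale (*) ?W (\<zeta> j \<circ> \<psi>)"
      using w(2)[OF j] iso' \<psi> by (auto simp: linear_on_def smooth_dual_def rep_iso_def)
    have "(\<forall>x \<in> ?W. (\<zeta> j \<circ> \<psi>) (action q (inv\<^bsub>G\<^esub> g) x) = (\<zeta> j \<circ> \<psi>) x) \<longleftrightarrow>
          (\<forall>v \<in> ?V. \<zeta> j (action r (inv\<^bsub>G\<^esub> g) v) = \<zeta> j v)" if "g \<in> carrier G" for g
      unfolding WV using that \<psi>\<phi> V(7) by (simp add: eq[symmetric])
    then have "{g \<in> carrier G. \<forall>x \<in> ?W. (\<zeta> j \<circ> \<psi>) (action q (inv\<^bsub>G\<^esub> g) x) = (\<zeta> j \<circ> \<psi>) x} =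
       {g \<in> carrier G. \<forall>v \<in> ?V. \<zeta> j (action r (inv\<^bsub>G\<^esub> g) v) = \<zeta> j v}" by auto
    then show "openin T {g \<in> carrier G. \<forall>x \<in> ?W. (\<zeta> j \<circ> \<psi>) (action q (inv\<^bsub>G\<^esub> g) x) = (\<zeta> j \<circ> \<psi>) x}"
      using w(2)[OF j] by (simp add: smooth_dual_def)
  qed
  then show "fell_data G T q n (\<lambda>j. \<phi> (w j)) (\<lambda>j. \<zeta> j \<circ> \<psi>)"
    using w(1) WV by (auto simp: fell_data_def)
  show "\<And>j g. j < n \<Longrightarrow> g \<in> carrier G \<Longrightarrow> (\<zeta> j \<circ> \<psi>) (action q g (\<phi> (w j))) = \<zeta> j (action r g (w j))"
    using w(1) \<psi>\<phi> V(7) by (simp add: eq[symmetric])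
qed

theorem openin_fell_nbhd:
  assumes TG: "topological_group G T" and r: "r \<in> irreps G T" and d: "fell_data G T r n v \<xi>"
    and B: "compactin T B" and "0 < \<epsilon>"
  shows "openin (fell_topology G T) (fell_nbhd G T r n v \<xi> B \<epsilon>)"
  unfolding openin_fell_topology fell_open_def
proof (intro conjI ballI fell_nbhd_subset)
  have G: "group G" and top: "topspace T = carrier G"
    using TG by (auto simp: topological_group_def)
  have BG: "B \<subseteq> carrier G" using compactin_subset_topspace[OF B] top by simp
  fix c p assume c: "c \<in> fell_nbhd G T r n v \<xi> B \<epsilon>" and p: "p \<in> c"
  then obtain q w \<zeta> where q: "c \<in> smooth_irr_classes G T" "q \<in> c" "fell_data G T q n w \<zeta>"
    and lt: "\<And>j g. j < n \<Longrightarrow> g \<in> B \<Longrightarrow> cmod (\<xi> j (action r g (v j)) - \<zeta> j (action q g (w j))) < \<epsilon>"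
    unfolding fell_nbhd_def by blast
  have "(q, p) \<in> iso_rel G T"
    using quotient_eq_iff[OF equiv_iso_rel, of c G T c q p] q(1,2) p
    by (simp add: smooth_irr_classes_def)
  then obtain \<phi> where q': "q \<in> irreps G T" and iso: "rep_iso G fun_scale fun_scale q p \<phi>"
    by (auto simp: iso_rel_def)
  define w' where "w' j = \<phi> (w j)" for j
  define \<zeta>' where "\<zeta>' j = \<zeta> j \<circ> inv_into (rep_space q) \<phi>" for j
  have d': "fell_data G T p n w' \<zeta>'"
    and eq: "\<And>j g. j < n \<Longrightarrow> g \<in> carrier G \<Longrightarrow> \<zeta>' j (action p g (w' j)) = \<zeta> j (action q g (w j))"
    using fell_data_transport[OF q' q(3) iso G] unfolding w'_def \<zeta>'_def by auto
  define D where "D j g = cmod (\<xi> j (action r g (v j)) - \<zeta> j (action q g (w j)))" for j g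
  define M where "M = insert 0 (\<Union>j<n. D j ` B)"
  have "finite (D j ` B)" if "j < n" for j
  proof -
    have "finite ((\<lambda>g. action r g (v j)) ` B)" "finite ((\<lambda>g. action q g (w j)) ` B)"
      using smooth_orbit_finite[OF TG _ _ B, of fun_scale] r q' d q(3) that
      by (auto simp: irreps_def fell_data_def)
    then have "finite ((\<lambda>(x, y). cmod (\<xi> j x - \<zeta> j y)) `
        ((\<lambda>g. action r g (v j)) ` B \<times> (\<lambda>g. action q g (w j)) ` B))" by blast
    moreover have "D j ` B \<subseteq> (\<lambda>(x, y). cmod (\<xi> j x - \<zeta> j y)) `
        ((\<lambda>g. action r g (v j)) ` B \<times> (\<lambda>g. action q g (w j)) ` B)"
      by (force simp: D_def)
    ultimately show ?thesis by (rule rev_finite_subset)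
  qed
  then have fin: "finite M" by (simp add: M_def)
  have "M \<noteq> {}" by (simp add: M_def)
  have "\<forall>x\<in>M. x < \<epsilon>" using lt \<open>0 < \<epsilon>\<close> by (auto simp: M_def D_def)
  then have pos: "0 < \<epsilon> - Max M" using fin \<open>M \<noteq> {}\<close> by simp
  have "fell_nbhd G T p n w' \<zeta>' B (\<epsilon> - Max M) \<subseteq> fell_nbhd G T r n v \<xi> B \<epsilon>"
  proof
    fix x assume "x \<in> fell_nbhd G T p n w' \<zeta>' B (\<epsilon> - Max M)"
    then obtain a u \<eta> where x: "x \<in> smooth_irr_classes G T" "a \<in> x" "fell_data G T a n u \<eta>"
      and l: "\<And>j g. j < n \<Longrightarrow> g \<in> B \<Longrightarrow>
          cmod (\<zeta>' j (action p g (w' j)) - \<eta> j (action a g (u j))) < \<epsilon> - Max M"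
      unfolding fell_nbhd_def by blast
    have "cmod (\<xi> j (action r g (v j)) - \<eta> j (action a g (u j))) < \<epsilon>" if "j < n" "g \<in> B" for j g
    proof -
      have "D j g \<le> Max M" using that fin by (intro Max_ge) (auto simp: M_def)
      moreover have "cmod (\<zeta> j (action q g (w j)) - \<eta> j (action a g (u j))) < \<epsilon> - Max M"
        using l[OF that] eq[of j g] that BG by auto
      moreover have "cmod (\<xi> j (action r g (v j)) - \<eta> j (action a g (u j))) \<le>
          D j g + cmod (\<zeta> j (action q g (w j)) - \<eta> j (action a g (u j)))"
        unfolding D_def by (rule norm_diff_triangle_le[OF order_refl order_refl]) 
      ultimately show ?thesis by linarith
    qed
    then show "x \<in> fell_nbhd G T r n v \<xi> B \<epsilon>" using x unfolding fell_nbhd_def by blast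
  qed
  then show "\<exists>m u \<eta> C \<delta>. fell_data G T p m u \<eta> \<and> compactin T C \<and> 0 < \<delta> \<and>
      fell_nbhd G T p m u \<eta> C \<delta> \<subseteq> fell_nbhd G T r n v \<xi> B \<epsilon>"
    using d' B pos by blast
qed

end

theory Submission
  imports Defs
begin

text \<open>Let \<open>\<pi>\<close> and \<open>\<rho>\<close> be irreducible such that every neighbourhood of \<open>\<pi>\<close> contains \<open>\<rho>\<close>. Choose a
  compact open subgroup \<open>K\<close> and a \<open>K\<close>-biinvariant matrix coefficient \<open>c \<noteq> 0\<close> of \<open>\<pi>\<close>. Averaging over
  \<open>K\<close> on both sides, \<open>c\<close> is approximated, uniformly on every compact open subgroup containing \<open>K\<close>, by
  \<open>K\<close>-biinvariant coefficients of \<open>\<rho>\<close>. By admissibility these span a finite-dimensional space of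
  functions. If \<open>c\<close> were not in this space, a finitely supported measure on \<open>G\<close> would annihilate the
  space but not \<open>c\<close>, contradicting the approximation on a compact open subgroup containing \<open>K\<close> and its
  support. So \<open>c\<close> is a finite sum of coefficients of \<open>\<rho>\<close>, which forces \<open>\<pi>\<close> and \<open>\<rho>\<close> to be
  isomorphic.\<close>

section \<open>Averaging over a compact subgroup\<close>

locale group_rep = G: group G + S: vector_space s
  for G :: "('a, 'b) monoid_scheme" (structure)
    and s :: "complex \<Rightarrow> 'v \<Rightarrow> 'v::ab_group_add" +
  fixes r :: "('a, 'v) rep"
  assumes rep: "representation G s r"

lemma group_repI: "group G \<Longrightarrow> representation G s r \<Longrightarrow> group_rep G s r"
  using representation_space(1) by (intro group_rep.intro group_rep_axioms.intro)

lemma irreducible_rep_representation: "irreducible_rep G s r \<Longrightarrow> representation G s r"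
  by (simp add: irreducible_rep_def)

context group_rep
begin

abbreviation "V \<equiv> rep_space r"
abbreviation "act \<equiv> action r"

lemma space:
  "S.subspace V" "0 \<in> V" "x \<in> V \<Longrightarrow> y \<in> V \<Longrightarrow> x + y \<in> V"
  "x \<in> V \<Longrightarrow> s c x \<in> V" "(\<And>i. i \<in> I \<Longrightarrow> f i \<in> V) \<Longrightarrow> sum f I \<in> V"
proof -
  show V: "S.subspace V" using representation_space(3)[OF rep] .
  then show "0 \<in> V" "x \<in> V \<Longrightarrow> y \<in> V \<Longrightarrow> x + y \<in> V"
    "x \<in> V \<Longrightarrow> s c x \<in> V" "(\<And>i. i \<in> I \<Longrightarrow> f i \<in> V) \<Longrightarrow> sum f I \<in> V"
    by (auto intro: S.subspace_0 S.subspace_add S.subspace_scale S.subspace_sum)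
qed

lemma act:
  "g \<in> carrier G \<Longrightarrow> x \<in> V \<Longrightarrow> act g x \<in> V"
  "g \<in> carrier G \<Longrightarrow> linear_on s s V (act g)"
  "x \<in> V \<Longrightarrow> act \<one> x = x"
  "g \<in> carrier G \<Longrightarrow> h \<in> carrier G \<Longrightarrow> x \<in> V \<Longrightarrow> act (g \<otimes> h) x = act g (act h x)"
  using rep by (auto simp: representation_def)

lemma act_add: "g \<in> carrier G \<Longrightarrow> x \<in> V \<Longrightarrow> y \<in> V \<Longrightarrow> act g (x + y) = act g x + act g y"
  and act_scale: "g \<in> carrier G \<Longrightarrow> x \<in> V \<Longrightarrow> act g (s c x) = s c (act g x)"
  using act(2) by (auto simp: linear_on_def)

lemma linear_on_sum:
  assumes f: "linear_on s t V f" and x: "\<And>i. i \<in> I \<Longrightarrow> x i \<in> V"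
  shows "f (sum x I) = (\<Sum>i\<in>I. f (x i))"
proof (cases "finite I")
  case True
  then show ?thesis using x
  proof (induction I rule: finite_induct)
    case empty
    then show ?case using linear_on_zero[OF f space(2)] by simp
  next
    case (insert i I)
    have "sum x I \<in> V" using insert by (intro space) auto
    then show ?case using insert f unfolding linear_on_def by simp
  qed
qed (use linear_on_zero[OF f space(2)] in simp)

lemma act_inv:
  assumes "g \<in> carrier G" "x \<in> V"
  shows "act (inv g) (act g x) = x" "act g (act (inv g) x) = x"
  using assms act(3) act(4)[of "inv g" g x] act(4)[of g "inv g" x] by auto

lemma act_inj: "g \<in> carrier G \<Longrightarrow> x \<in> V \<Longrightarrow> y \<in> V \<Longrightarrow> act g x = act g y \<longleftrightarrow> x = y"
  by (metis act_inv(1))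

lemma fixed_vectorsD: "x \<in> fixed_vectors r K \<Longrightarrow> x \<in> V" "x \<in> fixed_vectors r K \<Longrightarrow> k \<in> K \<Longrightarrow> act k x = x"
  by (auto simp: fixed_vectors_def)

end

text \<open>\<open>R\<close> represents the fibres of \<open>\<phi>\<close> on \<open>K\<close>, and
  \<open>m\<close> will be translation by an element of \<open>K\<close>. By \<open>inj\<close> and
  finiteness \<open>m\<close> permutes the fibres, so reindexing the representatives does not change
  the sum of a function that is constant on fibres.\<close>

lemma sum_transversal:
  assumes R: "inj_on \<phi> R" "\<phi> ` R = \<phi> ` K" "R \<subseteq> K" "finite R"
    and m: "\<And>k. k \<in> K \<Longrightarrow> m k \<in> K"
    and inj: "\<And>k k'. k \<in> K \<Longrightarrow> k' \<in> K \<Longrightarrow> \<phi> (m k) = \<phi> (m k') \<Longrightarrow> \<phi> k = \<phi> k'"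
    and F: "\<And>k k'. k \<in> K \<Longrightarrow> k' \<in> K \<Longrightarrow> \<phi> k = \<phi> k' \<Longrightarrow> F k = F k'"
  shows "(\<Sum>k\<in>R. F (m k)) = (\<Sum>k\<in>R. F k)"
proof -
  \<comment> \<open>The element \<open>m k\<close> may lie outside \<open>R\<close>;
    \<open>\<tau> k\<close> will be the representative of its fibre.\<close>
  have "\<exists>k'\<in>R. \<phi> k' = \<phi> (m k)" if "k \<in> R" for k
    using that R(2,3) m by (metis (no_types, lifting) imageE image_eqI subsetD)
  then obtain \<tau> where \<tau>: "\<And>k. k \<in> R \<Longrightarrow> \<tau> k \<in> R" "\<And>k. k \<in> R \<Longrightarrow> \<phi> (\<tau> k) = \<phi> (m k)"
    by metis
  have "inj_on \<tau> R"
    using \<tau> inj R(1,3) unfolding inj_on_def by (metis subsetD)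
  moreover have "\<tau> ` R = R"
    using \<tau>(1) by (intro endo_inj_surj[OF R(4)] \<open>inj_on \<tau> R\<close>) auto
  ultimately have "(\<Sum>k\<in>R. F k) = (\<Sum>k\<in>R. F (\<tau> k))"
    by (metis (no_types, lifting) comp_apply sum.cong sum.reindex)
  also have "\<dots> = (\<Sum>k\<in>R. F (m k))"
    using \<tau> m F R(3) by (intro sum.cong refl F) (auto simp: subset_iff)
  finally show ?thesis by simp
qed

locale smooth_group_rep = group_rep G s r
  for G :: "('a, 'b) monoid_scheme" (structure)
    and s :: "complex \<Rightarrow> 'v \<Rightarrow> 'v::ab_group_add"
    and r :: "('a, 'v) rep" +
  fixes T :: "'a topology" and K :: "'a set"
  assumes TG: "topological_group G T" and smooth: "smooth_rep G T s r"
    and K: "compactin T K" "subgroup K G"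
begin

lemma K_closed: "k \<in> K \<Longrightarrow> k \<in> carrier G" "\<one> \<in> K" "k \<in> K \<Longrightarrow> l \<in> K \<Longrightarrow> k \<otimes> l \<in> K" "k \<in> K \<Longrightarrow> inv k \<in> K"
  using K(2) by (auto simp: subgroup.one_closed subgroup.m_closed subgroup.m_inv_closed dest: subgroup.mem_carrier)

text \<open>Orbits of smooth vectors under the compact \<open>K\<close> are finite, so
  \<open>K\<close> acts on the orbits of \<open>Y\<close> through a finite group of permutations.
  Taking one element of \<open>K\<close> for each permutation gives a finite substitute for Haar
  measure, and translation by \<open>h\<close> on either side permutes these choices.\<close>

lemma averaging_set:
  assumes Y: "finite Y" "Y \<subseteq> V"
  obtains R where "finite R" "R \<noteq> {}" "R \<subseteq> K"
    "\<And>y h. y \<in> Y \<Longrightarrow> h \<in> K \<Longrightarrow> (\<Sum>k\<in>R. act h (act k y)) = (\<Sum>k\<in>R. act k y)"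
    "\<And>y h. y \<in> Y \<Longrightarrow> h \<in> K \<Longrightarrow> (\<Sum>k\<in>R. act k (act h y)) = (\<Sum>k\<in>R. act k y)"
proof -
  define Z where "Z = (\<Union>y\<in>Y. (\<lambda>k. act k y) ` K)"
  have Z: "finite Z" unfolding Z_def using Y smooth_orbit_finite[OF TG smooth _ K(1)] by blast
  have ZV: "z \<in> V" if "z \<in> Z" for z using that Y(2) act(1) K_closed(1) unfolding Z_def by blast
  have actZ: "act k z \<in> Z" if kz: "k \<in> K" "z \<in> Z" for k z
  proof -
    obtain y l where "y \<in> Y" "l \<in> K" "z = act l y" using kz(2) unfolding Z_def by blast
    moreover have "act (k \<otimes> l) y = act k (act l y)"
      using calculation kz Y(2) K_closed(1) by (intro act(4)) auto
    ultimately show ?thesis unfolding Z_def using K_closed(3)[OF kz(1) \<open>l \<in> K\<close>]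
      by (intro UN_I[of y] image_eqI[of _ _ "k \<otimes> l"]) auto
  qed
  have YZ: "Y \<subseteq> Z"
  proof
    fix y assume "y \<in> Y"
    then have "y = act \<one> y" using act(3) Y(2) by auto
    then show "y \<in> Z" using \<open>y \<in> Y\<close> K_closed(2) unfolding Z_def by blast
  qed
  \<comment> \<open>Restricting to \<open>Z\<close> puts the images in the finite set of maps from
    \<open>Z\<close> to itself, and \<open>\<phi> k = \<phi> k'\<close> then means that both
    elements act alike on \<open>Z\<close>.\<close>
  define \<phi> where "\<phi> k = restrict (act k) Z" for k
  have \<phi>_iff: "\<phi> k = \<phi> k' \<longleftrightarrow> (\<forall>z\<in>Z. act k z = act k' z)" for k k'
    unfolding \<phi>_def by (metis restrict_apply' restrict_ext)
  have "\<phi> ` K \<subseteq> Z \<rightarrow>\<^sub>E Z" unfolding \<phi>_def using actZ by auto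
  then have fin: "finite (\<phi> ` K)" using Z by (meson finite_PiE finite_subset)
  obtain R where R: "R \<subseteq> K" "inj_on \<phi> R" "\<phi> ` R = \<phi> ` K"
    by (metis subset_image_inj order_refl)
  have finR: "finite R" using fin R(2,3) by (metis finite_imageD)
  show thesis
  proof (rule that)
    show "R \<noteq> {}" using R(3) K_closed(2) by auto
    show "(\<Sum>k\<in>R. act h (act k y)) = (\<Sum>k\<in>R. act k y)" if yh: "y \<in> Y" "h \<in> K" for y h
    proof -
      have "(\<Sum>k\<in>R. act (h \<otimes> k) y) = (\<Sum>k\<in>R. act k y)"
      proof (rule sum_transversal[OF R(2,3,1) finR])
        show "h \<otimes> k \<in> K" if "k \<in> K" for k using that yh K_closed(3) by blast
        show "act k y = act k' y" if "k \<in> K" "k' \<in> K" "\<phi> k = \<phi> k'" for k k'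
          using that yh YZ \<phi>_iff by blast
        show "\<phi> k = \<phi> k'" if "k \<in> K" "k' \<in> K" "\<phi> (h \<otimes> k) = \<phi> (h \<otimes> k')" for k k'
          using that yh(2) act(1,4) act_inj[of h] ZV K_closed(1) unfolding \<phi>_iff by (metis (no_types, lifting))
      qed
      moreover have "(\<Sum>k\<in>R. act (h \<otimes> k) y) = (\<Sum>k\<in>R. act h (act k y))"
        using yh R(1) Y(2) K_closed(1) by (intro sum.cong refl act(4)) auto
      ultimately show ?thesis by simp
    qed
    show "(\<Sum>k\<in>R. act k (act h y)) = (\<Sum>k\<in>R. act k y)" if yh: "y \<in> Y" "h \<in> K" for y h
    proof -
      have "(\<Sum>k\<in>R. act (k \<otimes> h) y) = (\<Sum>k\<in>R. act k y)"
      proof (rule sum_transversal[OF R(2,3,1) finR])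
        show "k \<otimes> h \<in> K" if "k \<in> K" for k using that yh K_closed(3) by blast
        show "act k y = act k' y" if "k \<in> K" "k' \<in> K" "\<phi> k = \<phi> k'" for k k'
          using that yh YZ \<phi>_iff by blast
        show "\<phi> k = \<phi> k'" if kk: "k \<in> K" "k' \<in> K" "\<phi> (k \<otimes> h) = \<phi> (k' \<otimes> h)" for k k'
          unfolding \<phi>_iff
        proof
          \<comment> \<open>Agreement of \<open>k \<otimes> h\<close> and
            \<open>k' \<otimes> h\<close> at \<open>act (inv h) z\<close> is agreement of
            \<open>k\<close> and \<open>k'\<close> at \<open>z\<close>. This uses that
            \<open>Z\<close> is stable under \<open>K\<close>, which is why \<open>\<phi>\<close>
            records the action on \<open>Z\<close> and not only on \<open>Y\<close>.\<close>
          fix z assume z: "z \<in> Z"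
          have 1: "act (inv h) z \<in> Z" using actZ z yh K_closed(4) by blast
          then have "act (k \<otimes> h) (act (inv h) z) = act (k' \<otimes> h) (act (inv h) z)"
            using kk(3) \<phi>_iff by blast
          then show "act k z = act k' z"
            using kk yh K_closed(1) z ZV 1 by (simp add: act(4) act_inv)
        qed
      qed
      moreover have "(\<Sum>k\<in>R. act (k \<otimes> h) y) = (\<Sum>k\<in>R. act k (act h y))"
        using yh R(1) Y(2) K_closed(1) by (intro sum.cong refl act(4)) auto
      ultimately show ?thesis by simp
    qed
  qed (use R finR in auto)
qed

text \<open>\<open>E\<close> is the projection of \<open>V\<close> onto the \<open>K\<close>-fixed
  vectors. A finite averaging set serves only finitely many vectors at a time, so \<open>E\<close>
  is defined vector by vector and shown independent of the set; linearity follows from a set common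
  to the vectors involved. The last property, an average of \<open>K\<close>-translates, is kept for
  norm estimates.\<close>

lemma averaging_projection:
  obtains E where "linear_on s s V E" "\<And>x. x \<in> V \<Longrightarrow> E x \<in> fixed_vectors r K"
    "\<And>x. x \<in> fixed_vectors r K \<Longrightarrow> E x = x"
    "\<And>x h. x \<in> V \<Longrightarrow> h \<in> K \<Longrightarrow> E (act h x) = E x"
    "\<And>x. x \<in> V \<Longrightarrow> \<exists>R. finite R \<and> R \<noteq> {} \<and> R \<subseteq> K \<and> E x = s (1 / of_nat (card R)) (\<Sum>k\<in>R. act k x)"
proof -
  \<comment> \<open>\<open>P R Y\<close> says that \<open>R\<close> is an averaging set for all
    vectors of \<open>Y\<close>, with invariance on both sides.\<close>
  define P where "P R Y \<longleftrightarrow> finite R \<and> R \<noteq> {} \<and> R \<subseteq> K \<and>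
     (\<forall>y\<in>Y. \<forall>h\<in>K. (\<Sum>k\<in>R. act h (act k y)) = (\<Sum>k\<in>R. act k y) \<and>
        (\<Sum>k\<in>R. act k (act h y)) = (\<Sum>k\<in>R. act k y))" for R Y
  define avg where "avg R x = s (1 / of_nat (card R)) (\<Sum>k\<in>R. act k x)" for R x
  have ex: "\<exists>R. P R Y" if "finite Y" "Y \<subseteq> V" for Y
    using averaging_set[OF that] unfolding P_def by metis
  define E where "E x = avg (SOME R. P R {x}) x" for x
  have kV: "act k x \<in> V" if "P R Y" "k \<in> R" "x \<in> V" for k R Y x
    using that K_closed(1) act(1) unfolding P_def by blast
  have avgV: "avg R x \<in> V" if "P R Y" "x \<in> V" for R Y x
    unfolding avg_def using kV[OF that(1)] that(2) by (intro space) auto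
  have P1: "\<exists>R. P R {x} \<and> E x = avg R x" if "x \<in> V" for x
    using someI_ex[OF ex[of "{x}"]] that unfolding E_def by auto
  have fixed: "act h (avg R x) = avg R x" if "P R Y" "x \<in> Y" "x \<in> V" "h \<in> K" for R Y x h
  proof -
    have "act h (avg R x) = s (1 / of_nat (card R)) (act h (\<Sum>k\<in>R. act k x))"
      unfolding avg_def using that kV[OF that(1)] K_closed(1) by (intro act_scale space) auto
    also have "act h (\<Sum>k\<in>R. act k x) = (\<Sum>k\<in>R. act h (act k x))"
      using that kV[OF that(1)] K_closed(1) by (intro linear_on_sum[OF act(2)]) auto
    also have "\<dots> = (\<Sum>k\<in>R. act k x)" using that unfolding P_def by blast
    finally show ?thesis unfolding avg_def .
  qed
  have avg_const: "s (1 / of_nat (card R)) (\<Sum>k\<in>R. x) = x" if "P R Y" for R Y x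
  proof -
    have "card R \<noteq> 0" using that by (auto simp: P_def)
    moreover have "(\<Sum>k\<in>R. x) = s (of_nat (card R)) x"
      by (simp add: S.sum_constant_scale)
    ultimately show ?thesis by simp
  qed
  text \<open>Averaging over \<open>R\<close> the average over \<open>R'\<close> gives the average over \<open>R'\<close> by left invariance of
    the latter, and the average over \<open>R\<close> by right invariance of the former.\<close>
  have P_right: "(\<Sum>k\<in>R. act k (act h y)) = (\<Sum>k\<in>R. act k y)" if "P R Y" "y \<in> Y" "h \<in> K" for R Y y h
    using that(1)[unfolded P_def, THEN conjunct2, THEN conjunct2, THEN conjunct2, rule_format, OF that(2,3)] ..
  have indep: "avg R x = avg R' x" if PR: "P R Y" "P R' Y'" "x \<in> Y" "x \<in> Y'" "x \<in> V" for R R' Y Y' x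
  proof -
    have RK: "R \<subseteq> K" "R' \<subseteq> K" using PR by (auto simp: P_def)
    have "avg R' x = s (1 / of_nat (card R)) (\<Sum>k\<in>R. avg R' x)" using avg_const[OF PR(1)] by simp
    also have "(\<Sum>k\<in>R. avg R' x) = (\<Sum>k\<in>R. act k (avg R' x))"
      using fixed[OF PR(2,4,5)] RK by (intro sum.cong) auto
    also have "\<dots> = (\<Sum>k\<in>R. s (1 / of_nat (card R')) (\<Sum>k'\<in>R'. act k (act k' x)))"
    proof (intro sum.cong refl)
      fix k assume k: "k \<in> R"
      have "act k (avg R' x) = s (1 / of_nat (card R')) (act k (\<Sum>k'\<in>R'. act k' x))"
        unfolding avg_def using PR kV[OF PR(2)] K_closed(1) k RK by (intro act_scale space) auto
      also have "act k (\<Sum>k'\<in>R'. act k' x) = (\<Sum>k'\<in>R'. act k (act k' x))"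
        using PR kV[OF PR(2)] K_closed(1) k RK by (intro linear_on_sum[OF act(2)]) auto
      finally show "act k (avg R' x) = s (1 / of_nat (card R')) (\<Sum>k'\<in>R'. act k (act k' x))" .
    qed
    also have "\<dots> = s (1 / of_nat (card R')) (\<Sum>k'\<in>R'. \<Sum>k\<in>R. act k (act k' x))"
      unfolding S.scale_sum_right[symmetric] by (subst sum.swap) simp
    also have "(\<Sum>k'\<in>R'. \<Sum>k\<in>R. act k (act k' x)) = (\<Sum>k'\<in>R'. \<Sum>k\<in>R. act k x)"
    proof (rule sum.cong[OF refl])
      fix k' assume "k' \<in> R'"
      then show "(\<Sum>k\<in>R. act k (act k' x)) = (\<Sum>k\<in>R. act k x)"
        using P_right[OF PR(1,3)] RK(2) by blast
    qed
    also have "s (1 / of_nat (card R')) \<dots> = (\<Sum>k\<in>R. act k x)" using avg_const[OF PR(2)] .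
    finally show ?thesis unfolding avg_def by simp
  qed
  have E_eq: "E x = avg R x" if R: "P R Y" "x \<in> Y" "x \<in> V" for R Y x
  proof -
    obtain R' where "P R' {x}" "E x = avg R' x" using P1[OF R(3)] by blast
    then show ?thesis using indep[OF _ R(1) _ R(2,3), of R' "{x}"] by simp
  qed
  show thesis
  proof (rule that)
    show "linear_on s s V E"
      unfolding linear_on_def
    proof (intro conjI ballI allI)
      fix x y assume xy: "x \<in> V" "y \<in> V"
      \<comment> \<open>One averaging set for all three vectors reduces additivity of
        \<open>E\<close> to additivity of each \<open>act k\<close>.\<close>
      then obtain R where R: "P R {x, y, x + y}" using ex[of "{x, y, x + y}"] space(3) by auto
      have "(\<Sum>k\<in>R. act k (x + y)) = (\<Sum>k\<in>R. act k x) + (\<Sum>k\<in>R. act k y)"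
        unfolding sum.distrib[symmetric] using R xy K_closed(1) by (intro sum.cong refl act_add) (auto simp: P_def)
      then show "E (x + y) = E x + E y"
        using E_eq[OF R] xy space(3) by (simp add: avg_def S.scale_right_distrib)
    next
      fix c x assume x: "x \<in> V"
      then obtain R where R: "P R {x, s c x}" using ex[of "{x, s c x}"] space(4) by auto
      have "(\<Sum>k\<in>R. act k (s c x)) = s c (\<Sum>k\<in>R. act k x)"
        unfolding S.scale_sum_right using R x K_closed(1) by (intro sum.cong refl act_scale) (auto simp: P_def)
      then show "E (s c x) = s c (E x)"
        using E_eq[OF R] x space(4) by (simp add: avg_def mult.commute)
    qed
    show "E x \<in> fixed_vectors r K" if x: "x \<in> V" for x
      using P1[OF x] fixed avgV x unfolding fixed_vectors_def by force
    show "E x = x" if x: "x \<in> fixed_vectors r K" for x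
    proof -
      obtain R where R: "P R {x}" "E x = avg R x" using P1 x fixed_vectorsD(1) by blast
      have "(\<Sum>k\<in>R. act k x) = (\<Sum>k\<in>R. x)"
        using R x by (intro sum.cong) (auto simp: P_def fixed_vectors_def)
      then show ?thesis using R(2) avg_const[OF R(1)] by (simp add: avg_def)
    qed
    show "E (act h x) = E x" if xh: "x \<in> V" "h \<in> K" for x h
    proof -
      have hx: "act h x \<in> V" using xh act(1) K_closed(1) by blast
      obtain R where R: "P R {x, act h x}" using ex[of "{x, act h x}"] xh hx by auto
      have "(\<Sum>k\<in>R. act k (act h x)) = (\<Sum>k\<in>R. act k x)" using R xh unfolding P_def by blast
      then show ?thesis using E_eq[OF R] xh hx by (simp add: avg_def)
    qed
    show "\<exists>R. finite R \<and> R \<noteq> {} \<and> R \<subseteq> K \<and> E x = s (1 / of_nat (card R)) (\<Sum>k\<in>R. act k x)" if "x \<in> V" for x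
      using P1[OF that] unfolding P_def avg_def by blast
  qed
qed

end

section \<open>Open subgroups\<close>

text \<open>Together with \<open>g\<close> the set \<open>S\<close> contains the coset of
  \<open>K\<close> through \<open>g\<close>, which is an open neighbourhood of \<open>g\<close>: the
  preimage of \<open>K\<close> under left translation by the inverse of \<open>g\<close>.\<close>

lemma openin_right_invariant:
  assumes TG: "topological_group G T" and K: "openin T K" "\<one>\<^bsub>G\<^esub> \<in> K"
    and S: "S \<subseteq> carrier G" "\<And>g k. g \<in> S \<Longrightarrow> k \<in> K \<Longrightarrow> g \<otimes>\<^bsub>G\<^esub> k \<in> S"
  shows "openin T S"
proof (subst openin_subopen, intro ballI)
  fix g assume g: "g \<in> S"
  interpret G: group G using TG by (simp add: topological_group_def)
  have top: "topspace T = carrier G" using TG by (simp add: topological_group_def)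
  have gc: "g \<in> carrier G" using g S(1) by blast
  let ?U = "{h \<in> topspace T. inv\<^bsub>G\<^esub> g \<otimes>\<^bsub>G\<^esub> h \<in> K}"
  have mc: "continuous_map (prod_topology T T) T (\<lambda>(x, y). x \<otimes>\<^bsub>G\<^esub> y)"
    using TG by (simp add: topological_group_def)
  have "continuous_map T (prod_topology T T) (\<lambda>h. (inv\<^bsub>G\<^esub> g, h))"
    using gc top by (simp add: continuous_map_pairedI)
  from continuous_map_compose[OF this mc]
  have "continuous_map T T (\<lambda>h. inv\<^bsub>G\<^esub> g \<otimes>\<^bsub>G\<^esub> h)" by (simp add: o_def)
  then have "openin T ?U" using K(1) by (rule openin_continuous_map_preimage)
  moreover have "g \<in> ?U" using gc top K(2) by simp
  moreover have "?U \<subseteq> S"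
  proof
    fix h assume h: "h \<in> ?U"
    then have "g \<otimes>\<^bsub>G\<^esub> (inv\<^bsub>G\<^esub> g \<otimes>\<^bsub>G\<^esub> h) \<in> S" using S(2) g by blast
    then show "h \<in> S" using h gc top by (simp add: G.m_assoc[symmetric])
  qed
  ultimately show "\<exists>U. openin T U \<and> g \<in> U \<and> U \<subseteq> S" by blast
qed

text \<open>An open subgroup is also closed, since its complement is a union of its cosets; so it
  meets the compact \<open>M\<close> in a compact set.\<close>

lemma compact_open_subgroup_Int:
  assumes TG: "topological_group G T" and M: "compact_open_subgroup G T M"
    and H: "subgroup H G" "openin T H"
  shows "compact_open_subgroup G T (M \<inter> H)"
proof -
  interpret G: group G using TG by (simp add: topological_group_def)
  interpret H: subgroup H G by (rule H(1))
  have top: "topspace T = carrier G" using TG by (simp add: topological_group_def)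
  have "openin T (carrier G - H)"
  proof (rule openin_right_invariant[OF TG H(2)])
    fix g k assume g: "g \<in> carrier G - H" and k: "k \<in> H"
    have "g \<in> H" if "g \<otimes>\<^bsub>G\<^esub> k \<in> H"
    proof -
      have "g \<otimes>\<^bsub>G\<^esub> k \<otimes>\<^bsub>G\<^esub> inv\<^bsub>G\<^esub> k \<in> H" using that k by blast
      then show ?thesis using g k by (simp add: G.m_assoc)
    qed
    then show "g \<otimes>\<^bsub>G\<^esub> k \<in> carrier G - H" using g k by auto
  qed auto
  then have "closedin T H" using top H.subset by (simp add: closedin_def)
  then show ?thesis
    using M H G.subgroups_Inter_pair compact_Int_closedin
    by (auto simp: compact_open_subgroup_def)
qed

lemma (in group_rep) stabilizer_subgroup:
  assumes "v \<in> V"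
  shows "subgroup {g \<in> carrier G. act g v = v} G"
proof
  show "inv g \<in> {g \<in> carrier G. act g v = v}" if "g \<in> {g \<in> carrier G. act g v = v}" for g
    using that act_inv(1)[of g v] assms by auto
qed (use assms act(3) act(4)[OF _ _ assms] in auto)

section \<open>Comparing matrix coefficients\<close>

text \<open>Either \<open>c\<close> lies in the span of the \<open>a i\<close> on \<open>S\<close>,
  or a finitely supported measure \<open>\<mu>\<close> separates it from that span. The induction
  adjoins one function \<open>a j\<close> and asks first whether it depends on the earlier
  ones.\<close>

lemma finite_family_separation:
  fixes a :: "'i \<Rightarrow> 'a \<Rightarrow> 'k::field"
  assumes "finite I"
  shows "(\<exists>l. \<forall>g\<in>S. c g = (\<Sum>i\<in>I. l i * a i g)) \<or>
    (\<exists>F \<mu>. finite F \<and> F \<subseteq> S \<and> (\<forall>i\<in>I. (\<Sum>g\<in>F. \<mu> g * a i g) = 0) \<and> (\<Sum>g\<in>F. \<mu> g * c g) = 1)"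
  using assms
proof (induction I arbitrary: c rule: finite_induct)
  case empty
  show ?case
  proof (cases "\<forall>g\<in>S. c g = 0")
    case False
    then obtain g where "g \<in> S" "c g \<noteq> 0" by blast
    then show ?thesis by (intro disjI2 exI[of _ "{g}"] exI[of _ "\<lambda>_. 1 / c g"]) simp
  qed simp
next
  case (insert j I)
  note IH = insert.IH
  have ins: "(\<Sum>i\<in>insert j I. f i) = f j + (\<Sum>i\<in>I. f i)" for f :: "'i \<Rightarrow> 'k"
    using insert by simp
  consider (dep) l where "\<forall>g\<in>S. a j g = (\<Sum>i\<in>I. l i * a i g)"
    | (indep) F \<mu> where "finite F" "F \<subseteq> S" "\<forall>i\<in>I. (\<Sum>g\<in>F. \<mu> g * a i g) = 0" "(\<Sum>g\<in>F. \<mu> g * a j g) = 1"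
    using IH[of "a j"] by blast
  then show ?case
  proof cases
    \<comment> \<open>Any measure that kills the earlier functions kills \<open>a j\<close> as well,
      so the alternatives for \<open>c\<close> carry over.\<close>
    case dep
    show ?thesis using IH[of c]
    proof (elim disjE exE conjE)
      fix m assume "\<forall>g\<in>S. c g = (\<Sum>i\<in>I. m i * a i g)"
      then have "\<forall>g\<in>S. c g = (\<Sum>i\<in>insert j I. (m(j := 0)) i * a i g)"
        unfolding ins using insert by (auto intro!: sum.cong)
      then show ?thesis by blast
    next
      fix F \<mu> assume F: "finite F" "F \<subseteq> S" "\<forall>i\<in>I. (\<Sum>g\<in>F. \<mu> g * a i g) = 0" "(\<Sum>g\<in>F. \<mu> g * c g) = 1"
      have "(\<Sum>g\<in>F. \<mu> g * a j g) = (\<Sum>g\<in>F. \<Sum>i\<in>I. l i * (\<mu> g * a i g))"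
        using F(2) dep by (intro sum.cong refl) (auto simp: sum_distrib_left subset_iff algebra_simps)
      also have "\<dots> = (\<Sum>i\<in>I. l i * (\<Sum>g\<in>F. \<mu> g * a i g))"
        unfolding sum_distrib_left by (rule sum.swap)
      also have "\<dots> = 0" using F(3) by simp
      finally show ?thesis using F by blast
    qed
  next
    case indep
    \<comment> \<open>Here \<open>\<mu>\<close> kills the earlier functions and takes the value 1 on
      \<open>a j\<close>; subtracting \<open>p * a j\<close> from \<open>c\<close> makes its
      integral against \<open>\<mu>\<close> vanish.\<close>
    define p where "p = (\<Sum>g\<in>F. \<mu> g * c g)"
    show ?thesis using IH[of "\<lambda>g. c g - p * a j g"]
    proof (elim disjE exE conjE)
      fix m assume m: "\<forall>g\<in>S. c g - p * a j g = (\<Sum>i\<in>I. m i * a i g)"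
      have "c g = (\<Sum>i\<in>insert j I. (m(j := p)) i * a i g)" if "g \<in> S" for g
      proof -
        have "(\<Sum>i\<in>I. (m(j := p)) i * a i g) = (\<Sum>i\<in>I. m i * a i g)"
          using insert by (intro sum.cong) auto
        then show ?thesis unfolding ins using m that by (simp add: algebra_simps)
      qed
      then show ?thesis by blast
    next
      fix F' \<mu>' assume F': "finite F'" "F' \<subseteq> S" "\<forall>i\<in>I. (\<Sum>g\<in>F'. \<mu>' g * a i g) = 0"
        "(\<Sum>g\<in>F'. \<mu>' g * (c g - p * a j g)) = 1"
      define q where "q = (\<Sum>g\<in>F'. \<mu>' g * a j g)"
      \<comment> \<open>Subtracting \<open>q\<close> times \<open>\<mu>\<close> from
        \<open>\<mu>'\<close> makes the result kill \<open>a j\<close>. Its value on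
        \<open>c\<close> is that of \<open>\<mu>'\<close> minus \<open>q * p\<close>, which is the
        value of \<open>\<mu>'\<close> on \<open>c - p * a j\<close>, namely 1.\<close>
      define \<nu> where "\<nu> g = (if g \<in> F' then \<mu>' g else 0) - q * (if g \<in> F then \<mu> g else 0)" for g
      have \<nu>: "(\<Sum>g\<in>F \<union> F'. \<nu> g * f g) = (\<Sum>g\<in>F'. \<mu>' g * f g) - q * (\<Sum>g\<in>F. \<mu> g * f g)" for f
      proof -
        have "(\<Sum>g\<in>F \<union> F'. (if g \<in> F' then \<mu>' g else 0) * f g) = (\<Sum>g\<in>F'. \<mu>' g * f g)"
          using indep(1) F'(1) by (intro sum.mono_neutral_cong_right) auto
        moreover have "(\<Sum>g\<in>F \<union> F'. (if g \<in> F then \<mu> g else 0) * f g) = (\<Sum>g\<in>F. \<mu> g * f g)"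
          using indep(1) F'(1) by (intro sum.mono_neutral_cong_right) auto
        ultimately show ?thesis
          unfolding \<nu>_def left_diff_distrib sum_subtractf mult.assoc sum_distrib_left[symmetric] by simp
      qed
      have "(\<Sum>g\<in>F'. \<mu>' g * (c g - p * a j g)) = (\<Sum>g\<in>F'. \<mu>' g * c g) - p * q"
        unfolding q_def sum_distrib_left sum_subtractf[symmetric]
        by (intro sum.cong refl) (simp add: algebra_simps)
      then have "(\<Sum>g\<in>F \<union> F'. \<nu> g * c g) = 1"
        using F'(4) unfolding \<nu> p_def[symmetric] by (simp add: mult.commute)
      moreover have "\<forall>i\<in>insert j I. (\<Sum>g\<in>F \<union> F'. \<nu> g * a i g) = 0"
        unfolding \<nu> using indep F' q_def by auto
      moreover have "finite (F \<union> F')" "F \<union> F' \<subseteq> S" using indep F' by auto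
      ultimately show ?thesis by blast
    qed
  qed
qed

section \<open>Isomorphisms from identities between coefficients\<close>

text \<open>A form of Schur's lemma for a subrepresentation \<open>\<Gamma>\<close> of the product:
  its domain, its range and its kernel are invariant subspaces, so irreducibility makes the first
  two full and the third zero. By \<open>single\<close> it is the graph of a function.\<close>

lemma rep_iso_of_graph:
  fixes s :: "complex \<Rightarrow> 'v \<Rightarrow> 'v::ab_group_add" and t :: "complex \<Rightarrow> 'w \<Rightarrow> 'w::ab_group_add"
  assumes r: "irreducible_rep G s r" and q: "irreducible_rep G t q"
    and \<Gamma>: "\<Gamma> \<subseteq> rep_space q \<times> rep_space r"
      "\<And>x v y u. (x, v) \<in> \<Gamma> \<Longrightarrow> (y, u) \<in> \<Gamma> \<Longrightarrow> (x + y, v + u) \<in> \<Gamma>"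
      "\<And>c x v. (x, v) \<in> \<Gamma> \<Longrightarrow> (t c x, s c v) \<in> \<Gamma>"
      "\<And>g x v. g \<in> carrier G \<Longrightarrow> (x, v) \<in> \<Gamma> \<Longrightarrow> (action q g x, action r g v) \<in> \<Gamma>"
    and single: "\<And>v. (0, v) \<in> \<Gamma> \<Longrightarrow> v = 0"
    and nonzero: "(x0, v0) \<in> \<Gamma>" "v0 \<noteq> 0"
  shows "\<exists>\<phi>. rep_iso G t s q r \<phi>"
proof -
  have rr: "representation G s r" and qq: "representation G t q"
    using r q by (auto simp: irreducible_rep_def)
  interpret S: vector_space s using representation_space(1)[OF rr] .
  interpret T: vector_space t using representation_space(1)[OF qq] .
  have irr_r: "W = {0} \<or> W = rep_space r"
    if "S.subspace W" "W \<subseteq> rep_space r" "\<And>g w. g \<in> carrier G \<Longrightarrow> w \<in> W \<Longrightarrow> action r g w \<in> W" for W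
    using r that unfolding irreducible_rep_def by blast
  have irr_q: "W = {0} \<or> W = rep_space q"
    if "T.subspace W" "W \<subseteq> rep_space q" "\<And>g w. g \<in> carrier G \<Longrightarrow> w \<in> W \<Longrightarrow> action q g w \<in> W" for W
    using q that unfolding irreducible_rep_def by blast
  have zero: "(0, 0) \<in> \<Gamma>" using \<Gamma>(3)[OF nonzero(1), of 0] by simp
  have x0: "x0 \<noteq> 0" using single nonzero by blast
  have diff: "(x - y, v - u) \<in> \<Gamma>" if "(x, v) \<in> \<Gamma>" "(y, u) \<in> \<Gamma>" for x v y u
    using \<Gamma>(2)[OF that(1) \<Gamma>(3)[OF that(2), of "-1"]] by simp
  have functional: "v = u" if "(x, v) \<in> \<Gamma>" "(x, u) \<in> \<Gamma>" for x v u
    using single[of "v - u"] diff[OF that] by simp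
  have "Domain \<Gamma> = {0} \<or> Domain \<Gamma> = rep_space q"
  proof (rule irr_q)
    show "T.subspace (Domain \<Gamma>)"
      unfolding T.subspace_def
    proof (intro conjI ballI allI)
      show "0 \<in> Domain \<Gamma>" using zero by (rule DomainI)
      show "x + y \<in> Domain \<Gamma>" if "x \<in> Domain \<Gamma>" "y \<in> Domain \<Gamma>" for x y
        using that by (elim DomainE) (rule DomainI, rule \<Gamma>(2))
      show "t c x \<in> Domain \<Gamma>" if "x \<in> Domain \<Gamma>" for c x
        using that by (elim DomainE) (rule DomainI, rule \<Gamma>(3))
    qed
    show "Domain \<Gamma> \<subseteq> rep_space q" using \<Gamma>(1) by blast
    show "action q g w \<in> Domain \<Gamma>" if "g \<in> carrier G" "w \<in> Domain \<Gamma>" for g w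
      using that(2) by (elim DomainE) (rule DomainI, rule \<Gamma>(4)[OF that(1)])
  qed
  then have dom: "Domain \<Gamma> = rep_space q" using nonzero(1) x0 by blast
  have "Range \<Gamma> = {0} \<or> Range \<Gamma> = rep_space r"
  proof (rule irr_r)
    show "S.subspace (Range \<Gamma>)"
      unfolding S.subspace_def
    proof (intro conjI ballI allI)
      show "0 \<in> Range \<Gamma>" using zero by (rule RangeI)
      show "x + y \<in> Range \<Gamma>" if "x \<in> Range \<Gamma>" "y \<in> Range \<Gamma>" for x y
        using that by (elim RangeE) (rule RangeI, rule \<Gamma>(2))
      show "s c x \<in> Range \<Gamma>" if "x \<in> Range \<Gamma>" for c x
        using that by (elim RangeE) (rule RangeI, rule \<Gamma>(3))
    qed
    show "Range \<Gamma> \<subseteq> rep_space r" using \<Gamma>(1) by blast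
    show "action r g w \<in> Range \<Gamma>" if "g \<in> carrier G" "w \<in> Range \<Gamma>" for g w
      using that(2) by (elim RangeE) (rule RangeI, rule \<Gamma>(4)[OF that(1)])
  qed
  then have ran: "Range \<Gamma> = rep_space r" using nonzero by blast
  have act0: "action r g 0 = 0" if "g \<in> carrier G" for g
    using rr that representation_space(4)[OF rr] linear_on_zero[of s s "rep_space r" "action r g"]
    by (auto simp: representation_def)
  \<comment> \<open>The kernel is not the whole space, because \<open>x0\<close> is paired with the
    nonzero vector \<open>v0\<close> and with nothing else.\<close>
  have "{x. (x, 0) \<in> \<Gamma>} = {0} \<or> {x. (x, 0) \<in> \<Gamma>} = rep_space q"
  proof (rule irr_q)
    show "T.subspace {x. (x, 0) \<in> \<Gamma>}"
      unfolding T.subspace_def using zero \<Gamma>(2)[of _ 0 _ 0] \<Gamma>(3)[of _ 0] by auto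
    show "action q g w \<in> {x. (x, 0) \<in> \<Gamma>}" if "g \<in> carrier G" "w \<in> {x. (x, 0) \<in> \<Gamma>}" for g w
      using that \<Gamma>(4)[of g w 0] act0 by auto
  qed (use \<Gamma>(1) in blast)
  moreover have "(x0, 0) \<notin> \<Gamma>" using functional nonzero by blast
  ultimately have ker: "x = 0" if "(x, 0) \<in> \<Gamma>" for x
    using that dom nonzero(1) by blast
  have inj: "x = y" if "(x, v) \<in> \<Gamma>" "(y, v) \<in> \<Gamma>" for x y v
    using ker[of "x - y"] diff[OF that] by simp
  define \<phi> where "\<phi> x = (THE v. (x, v) \<in> \<Gamma>)" for x
  have \<phi>_eq: "\<phi> x = v" if "(x, v) \<in> \<Gamma>" for x v
    unfolding \<phi>_def
  proof (rule the_equality)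
    show "u = v" if "(x, u) \<in> \<Gamma>" for u using functional[OF that \<open>(x, v) \<in> \<Gamma>\<close>] .
  qed (rule that)
  have \<phi>: "(x, \<phi> x) \<in> \<Gamma>" if x: "x \<in> rep_space q" for x
  proof -
    obtain v where "(x, v) \<in> \<Gamma>" using x dom by blast
    then show ?thesis using \<phi>_eq by simp
  qed
  have "rep_iso G t s q r \<phi>"
    unfolding rep_iso_def
  proof (intro conjI ballI)
    show "bij_betw \<phi> (rep_space q) (rep_space r)"
      unfolding bij_betw_def
    proof (intro conjI)
      show "inj_on \<phi> (rep_space q)" using \<phi> inj by (metis inj_onI)
      show "\<phi> ` rep_space q = rep_space r"
      proof
        show "\<phi> ` rep_space q \<subseteq> rep_space r" using \<phi> \<Gamma>(1) by blast
        show "rep_space r \<subseteq> \<phi> ` rep_space q"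
        proof
          fix v assume "v \<in> rep_space r"
          then obtain x where "(x, v) \<in> \<Gamma>" using ran by blast
          then show "v \<in> \<phi> ` rep_space q" using \<phi>_eq[of x v] \<Gamma>(1) by blast
        qed
      qed
    qed
    show "linear_on t s (rep_space q) \<phi>"
      unfolding linear_on_def by (intro conjI ballI allI \<phi>_eq \<Gamma>(2,3) \<phi>)
    show "\<phi> (action q g x) = action r g (\<phi> x)" if "g \<in> carrier G" "x \<in> rep_space q" for g x
      by (rule \<phi>_eq[OF \<Gamma>(4)[OF that(1) \<phi>[OF that(2)]]])
  qed
  then show ?thesis by blast
qed

text \<open>The vectors all of whose translates are killed by \<open>\<xi>\<close> form an invariant
  subspace. If it contained \<open>v\<close> it would be all of \<open>V\<close>, contradicting
  \<open>\<xi> x \<noteq> 0\<close>.\<close>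

lemma (in group_rep) coefficient_nonzero:
  assumes irr: "irreducible_rep G s r" and \<xi>: "linear_on s (*) V \<xi>" "x \<in> V" "\<xi> x \<noteq> (0::complex)"
    and v: "v \<in> V" "v \<noteq> 0"
  shows "\<exists>g\<in>carrier G. \<xi> (act g v) \<noteq> 0"
proof (rule ccontr)
  assume n: "\<not> ?thesis"
  define W where "W = {y \<in> V. \<forall>g\<in>carrier G. \<xi> (act g y) = 0}"
  have \<xi>0: "\<xi> 0 = 0" using linear_on_zero[OF \<xi>(1) space(2)] .
  have "S.subspace W"
    unfolding S.subspace_def W_def
  proof (intro conjI ballI allI; clarsimp)
    show "0 \<in> V \<and> (\<forall>g\<in>carrier G. \<xi> (act g 0) = 0)"
      using \<xi>0 space(2) linear_on_zero[OF act(2) space(2)] by simp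
    show "x + y \<in> V \<and> (\<forall>g\<in>carrier G. \<xi> (act g (x + y)) = 0)"
      if "x \<in> V" "y \<in> V" "\<forall>g\<in>carrier G. \<xi> (act g x) = 0" "\<forall>g\<in>carrier G. \<xi> (act g y) = 0" for x y
      using that \<xi>(1) act(1) space(3) by (simp add: act_add linear_on_def)
    show "s c x \<in> V \<and> (\<forall>g\<in>carrier G. \<xi> (act g (s c x)) = 0)"
      if "x \<in> V" "\<forall>g\<in>carrier G. \<xi> (act g x) = 0" for c x
      using that \<xi>(1) act(1) space(4) by (simp add: act_scale linear_on_def)
  qed
  moreover have "W \<subseteq> V" by (auto simp: W_def)
  moreover have "act h w \<in> W" if "h \<in> carrier G" "w \<in> W" for h w
    using that act(1) by (auto simp: W_def act(4)[symmetric])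
  ultimately have "W = {0} \<or> W = V" using irr unfolding irreducible_rep_def by blast
  moreover have "v \<in> W" using n v(1) by (simp add: W_def)
  ultimately have "x \<in> W" using v(2) \<xi>(2) by blast
  then have "\<xi> (act \<one> x) = 0" by (simp add: W_def)
  then show False using \<xi> act(3) by simp
qed

text \<open>Induction on the number of terms: the pairs \<open>(w j, v)\<close> occurring in such identities form an
  invariant subspace of \<open>rep_space q \<times> rep_space r\<close>. Either it is the graph of an isomorphism, or it
  contains some \<open>(0, v')\<close> with \<open>v' \<noteq> 0\<close>, which gives an identity with one term less.\<close>

lemma rep_iso_of_coefficients:
  fixes s :: "complex \<Rightarrow> 'v \<Rightarrow> 'v::ab_group_add" and t :: "complex \<Rightarrow> 'w \<Rightarrow> 'w::ab_group_add"
  assumes G: "group G" and r: "irreducible_rep G s r" and q: "irreducible_rep G t q"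
    and \<xi>: "linear_on s (*) (rep_space r) \<xi>" "x0 \<in> rep_space r" "\<xi> x0 \<noteq> (0::complex)"
    and "finite I" and \<zeta>: "\<And>i. i \<in> I \<Longrightarrow> linear_on t (*) (rep_space q) (\<zeta> i)"
    and v: "v \<in> rep_space r" "v \<noteq> 0" and w: "\<And>i. i \<in> I \<Longrightarrow> w i \<in> rep_space q"
    and eq: "\<And>g. g \<in> carrier G \<Longrightarrow> \<xi> (action r g v) = (\<Sum>i\<in>I. \<zeta> i (action q g (w i)))"
  shows "\<exists>\<phi>. rep_iso G t s q r \<phi>"
proof -
  interpret R: group_rep G s r
    by (rule group_repI[OF G irreducible_rep_representation[OF r]])
  interpret Q: group_rep G t q
    by (rule group_repI[OF G irreducible_rep_representation[OF q]])
  show ?thesis using \<open>finite I\<close> \<zeta> v w eq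
  proof (induction I arbitrary: v w rule: finite_induct)
    case empty
    obtain g where "g \<in> carrier G" "\<xi> (action r g v) \<noteq> 0"
      using R.coefficient_nonzero[OF r \<xi> empty(2,3)] by blast
    then show ?case using empty(5)[of g] by simp
  next
    case (insert j I)
    \<comment> \<open>Only the vector in the term \<open>j\<close> is recorded; the vectors of the
      other terms are quantified away, which leaves a relation between just two irreducible
      representations.\<close>
    define \<Gamma> where "\<Gamma> = {(x, u). x \<in> rep_space q \<and> u \<in> rep_space r \<and>
      (\<exists>w. (\<forall>i\<in>I. w i \<in> rep_space q) \<and>
        (\<forall>g\<in>carrier G. \<xi> (action r g u) = \<zeta> j (action q g x) + (\<Sum>i\<in>I. \<zeta> i (action q g (w i)))))}"
    have lin: "linear_on t (*) (rep_space q) (\<zeta> i)" if "i \<in> insert j I" for i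
      using insert.prems(1) that .
    have lin_add: "\<zeta> i (action q g (x + y)) = \<zeta> i (action q g x) + \<zeta> i (action q g y)"
      and lin_scale: "\<zeta> i (action q g (t c x)) = c * \<zeta> i (action q g x)"
      if "i \<in> insert j I" "g \<in> carrier G" "x \<in> rep_space q" "y \<in> rep_space q" for i g x y c
      using lin[OF that(1)] that Q.act(1) by (simp_all add: Q.act_add Q.act_scale linear_on_def)
    have \<xi>_add: "\<xi> (action r g (x + y)) = \<xi> (action r g x) + \<xi> (action r g y)"
      and \<xi>_scale: "\<xi> (action r g (s c x)) = c * \<xi> (action r g x)"
      if "g \<in> carrier G" "x \<in> rep_space r" "y \<in> rep_space r" for g x y c
      using \<xi>(1) that R.act(1) by (simp_all add: R.act_add R.act_scale linear_on_def)
    show ?case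
    proof (cases "\<exists>u. (0, u) \<in> \<Gamma> \<and> u \<noteq> 0")
      case True
      then obtain u w' where u: "u \<in> rep_space r" "u \<noteq> 0" and w': "\<forall>i\<in>I. w' i \<in> rep_space q"
        "\<forall>g\<in>carrier G. \<xi> (action r g u) = \<zeta> j (action q g 0) + (\<Sum>i\<in>I. \<zeta> i (action q g (w' i)))"
        unfolding \<Gamma>_def by blast
      have z: "\<zeta> j (action q g 0) = 0" if "g \<in> carrier G" for g
        using linear_on_zero[OF Q.act(2)[OF that] Q.space(2)] linear_on_zero[OF lin[of j] Q.space(2)] by simp
      show ?thesis
      proof (rule insert.IH[of u w'])
        show "\<xi> (action r g u) = (\<Sum>i\<in>I. \<zeta> i (action q g (w' i)))" if "g \<in> carrier G" for g
          using w'(2) z that by simp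
      qed (use lin u w'(1) in auto)
    next
      case False
      show ?thesis
      proof (rule rep_iso_of_graph[OF r q, of \<Gamma> "w j" v])
        show "\<Gamma> \<subseteq> rep_space q \<times> rep_space r" by (auto simp: \<Gamma>_def)
        show "(x + y, u + v) \<in> \<Gamma>" if "(x, u) \<in> \<Gamma>" "(y, v) \<in> \<Gamma>" for x u y v
        proof -
          obtain w1 where w1: "x \<in> rep_space q" "u \<in> rep_space r" "\<forall>i\<in>I. w1 i \<in> rep_space q"
            "\<And>g. g \<in> carrier G \<Longrightarrow> \<xi> (action r g u) = \<zeta> j (action q g x) + (\<Sum>i\<in>I. \<zeta> i (action q g (w1 i)))"
            using \<open>(x, u) \<in> \<Gamma>\<close> unfolding \<Gamma>_def by blast
          obtain w2 where w2: "y \<in> rep_space q" "v \<in> rep_space r" "\<forall>i\<in>I. w2 i \<in> rep_space q"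
            "\<And>g. g \<in> carrier G \<Longrightarrow> \<xi> (action r g v) = \<zeta> j (action q g y) + (\<Sum>i\<in>I. \<zeta> i (action q g (w2 i)))"
            using \<open>(y, v) \<in> \<Gamma>\<close> unfolding \<Gamma>_def by blast
          have "\<xi> (action r g (u + v)) = \<zeta> j (action q g (x + y)) + (\<Sum>i\<in>I. \<zeta> i (action q g (w1 i + w2 i)))"
            if g: "g \<in> carrier G" for g
          proof -
            have "(\<Sum>i\<in>I. \<zeta> i (action q g (w1 i + w2 i))) =
                (\<Sum>i\<in>I. \<zeta> i (action q g (w1 i))) + (\<Sum>i\<in>I. \<zeta> i (action q g (w2 i)))"
              unfolding sum.distrib[symmetric] using w1(3) w2(3) g by (intro sum.cong refl lin_add) auto
            then show ?thesis
              using \<xi>_add[OF g w1(2) w2(2)] lin_add[OF _ g w1(1) w2(1), of j] w1(4)[OF g] w2(4)[OF g] by simp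
          qed
          then show ?thesis
            using w1 w2 R.space(3) Q.space(3) unfolding \<Gamma>_def
            by (auto intro!: exI[of _ "\<lambda>i. w1 i + w2 i"])
        qed
        show "(t c x, s c u) \<in> \<Gamma>" if "(x, u) \<in> \<Gamma>" for c x u
        proof -
          obtain w1 where w1: "x \<in> rep_space q" "u \<in> rep_space r" "\<forall>i\<in>I. w1 i \<in> rep_space q"
            "\<And>g. g \<in> carrier G \<Longrightarrow> \<xi> (action r g u) = \<zeta> j (action q g x) + (\<Sum>i\<in>I. \<zeta> i (action q g (w1 i)))"
            using \<open>(x, u) \<in> \<Gamma>\<close> unfolding \<Gamma>_def by blast
          have "\<xi> (action r g (s c u)) = \<zeta> j (action q g (t c x)) + (\<Sum>i\<in>I. \<zeta> i (action q g (t c (w1 i))))"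
            if g: "g \<in> carrier G" for g
          proof -
            have "(\<Sum>i\<in>I. \<zeta> i (action q g (t c (w1 i)))) = c * (\<Sum>i\<in>I. \<zeta> i (action q g (w1 i)))"
              unfolding sum_distrib_left using w1(3) g by (intro sum.cong refl lin_scale) auto
            then show ?thesis
              using \<xi>_scale[OF g w1(2,2)] lin_scale[OF _ g w1(1,1), of j] w1(4)[OF g]
              by (simp add: distrib_left)
          qed
          then show ?thesis
            using w1 R.space(4) Q.space(4) unfolding \<Gamma>_def
            by (auto intro!: exI[of _ "\<lambda>i. t c (w1 i)"])
        qed
        show "(action q h x, action r h u) \<in> \<Gamma>" if h: "h \<in> carrier G" and "(x, u) \<in> \<Gamma>" for h x u
        proof -
          obtain w1 where w1: "x \<in> rep_space q" "u \<in> rep_space r" "\<forall>i\<in>I. w1 i \<in> rep_space q"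
            "\<And>g. g \<in> carrier G \<Longrightarrow> \<xi> (action r g u) = \<zeta> j (action q g x) + (\<Sum>i\<in>I. \<zeta> i (action q g (w1 i)))"
            using \<open>(x, u) \<in> \<Gamma>\<close> unfolding \<Gamma>_def by blast
          \<comment> \<open>Evaluating the identity at the product of \<open>g\<close> and
            \<open>h\<close> moves \<open>h\<close> onto all vectors at once.\<close>
          have "\<xi> (action r g (action r h u)) =
              \<zeta> j (action q g (action q h x)) + (\<Sum>i\<in>I. \<zeta> i (action q g (action q h (w1 i))))"
            if g: "g \<in> carrier G" for g
            using w1(4)[of "g \<otimes>\<^bsub>G\<^esub> h"] w1(1-3) g h by (simp add: R.act(4) Q.act(4))
          then show ?thesis
            using w1 R.act(1) Q.act(1) h unfolding \<Gamma>_def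
            by (auto intro!: exI[of _ "\<lambda>i. action q h (w1 i)"])
        qed
        show "(w j, v) \<in> \<Gamma>"
          using insert unfolding \<Gamma>_def by (auto intro!: exI[of _ w])
      qed (use False insert.prems in auto)
    qed
  qed
qed

section \<open>Approximation by biinvariant coefficients\<close>

text \<open>Any linear functional with value 1 at \<open>v\<close>, composed with the averaging
  projection \<open>E\<close>, works: \<open>E\<close> fixes \<open>v\<close> and absorbs the action
  of \<open>K\<close>. Since \<open>K\<close> is open, invariance under \<open>K\<close> makes the
  functional smooth.\<close>

lemma (in smooth_group_rep) invariant_functional_exists:
  assumes Ko: "openin T K" and v: "v \<in> fixed_vectors r K" "v \<noteq> 0"
  obtains \<xi> where "\<xi> \<in> smooth_dual G T s r" "\<xi> v = 1"
    "\<And>k x. k \<in> K \<Longrightarrow> x \<in> V \<Longrightarrow> \<xi> (act k x) = \<xi> x"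
proof -
  obtain E where E: "linear_on s s V E" "\<And>x. x \<in> V \<Longrightarrow> E x \<in> fixed_vectors r K"
    "\<And>x. x \<in> fixed_vectors r K \<Longrightarrow> E x = x"
    "\<And>x h. x \<in> V \<Longrightarrow> h \<in> K \<Longrightarrow> E (act h x) = E x"
    using averaging_projection by metis
  obtain \<eta> where \<eta>: "linear_on s (*) UNIV \<eta>" "\<eta> v = (1::complex)"
    using exists_functional[OF S.vector_space_axioms v(2)] by blast
  define \<xi> where "\<xi> x = \<eta> (E x)" for x
  have inv: "\<xi> (act k x) = \<xi> x" if "k \<in> K" "x \<in> V" for k x
    using E(4) that by (simp add: \<xi>_def)
  have "openin T {g \<in> carrier G. \<forall>x\<in>V. \<xi> (act (inv g) x) = \<xi> x}"
  proof (rule openin_right_invariant[OF TG Ko K_closed(2)])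
    fix g k assume g: "g \<in> {g \<in> carrier G. \<forall>x\<in>V. \<xi> (act (inv g) x) = \<xi> x}" and k: "k \<in> K"
    have kc: "k \<in> carrier G" using k K_closed(1) by blast
    have "\<xi> (act (inv (g \<otimes> k)) x) = \<xi> x" if x: "x \<in> V" for x
    proof -
      have "act (inv (g \<otimes> k)) x = act (inv k) (act (inv g) x)"
        using g kc x act(4)[of "inv k" "inv g" x] by (simp add: G.inv_mult_group)
      then show ?thesis using inv[OF K_closed(4)[OF k]] act(1)[of "inv g" x] g x by simp
    qed
    then show "g \<otimes> k \<in> {g \<in> carrier G. \<forall>x\<in>V. \<xi> (act (inv g) x) = \<xi> x}" using g kc by simp
  qed auto
  moreover have "linear_on s (*) V \<xi>"
    using E(1) \<eta>(1) by (simp add: linear_on_def \<xi>_def)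
  ultimately have "\<xi> \<in> smooth_dual G T s r" by (simp add: smooth_dual_def)
  then show thesis using that inv \<eta>(2) E(3)[OF v(1)] by (simp add: \<xi>_def)
qed

text \<open>This is where the filtered union of compact open subgroups enters: it places the finite
  support of a separating measure, together with \<open>K\<close>, inside one compact subgroup, on
  which the Fell topology controls coefficients.\<close>

lemma lc_group_finite_subset:
  assumes "lc_group G T" "compact_open_subgroup G T K" "finite F" "F \<subseteq> carrier G"
  shows "\<exists>M. compact_open_subgroup G T M \<and> K \<subseteq> M \<and> F \<subseteq> M"
  using assms(3,4)
proof (induction F rule: finite_induct)
  case (insert g F)
  then obtain M where M: "compact_open_subgroup G T M" "K \<subseteq> M" "F \<subseteq> M" by auto
  have "g \<in> carrier G" using insert by simp
  then obtain L where L: "compact_open_subgroup G T L" "g \<in> L"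
    using assms(1) unfolding lc_group_def by blast
  obtain M' where "compact_open_subgroup G T M'" "M \<subseteq> M'" "L \<subseteq> M'"
    using assms(1) M(1) L(1) unfolding lc_group_def by blast
  then show ?case using M L by (intro exI[of _ M']) auto
qed (use assms(2) in auto)

lemma (in group_rep) functional_average:
  assumes f: "linear_on s (*) V f" and R: "R \<subseteq> carrier G" and x: "x \<in> V"
  shows "f (s c (\<Sum>k\<in>R. act k x)) = c * (\<Sum>k\<in>R. f (act k x))"
proof -
  have kx: "act k x \<in> V" if "k \<in> R" for k using act(1) R x that by blast
  have "f (s c (\<Sum>k\<in>R. act k x)) = c * f (\<Sum>k\<in>R. act k x)"
    using f space(5)[of R "\<lambda>k. act k x", OF kx] unfolding linear_on_def by blast
  then show ?thesis using linear_on_sum[OF f, of R "\<lambda>k. act k x", OF kx] by simp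
qed

lemma average_close:
  fixes f :: "'i \<Rightarrow> complex"
  assumes "finite R" "R \<noteq> {}" and le: "\<And>k. k \<in> R \<Longrightarrow> cmod (c - f k) \<le> \<epsilon>"
  shows "cmod (c - 1 / of_nat (card R) * (\<Sum>k\<in>R. f k)) \<le> \<epsilon>"
proof -
  have n: "card R > 0" using assms by (simp add: card_gt_0_iff)
  have "c - 1 / of_nat (card R) * (\<Sum>k\<in>R. f k) = (\<Sum>k\<in>R. c - f k) / of_nat (card R)"
    using n by (simp add: sum_subtractf field_simps)
  also have "cmod \<dots> = cmod (\<Sum>k\<in>R. c - f k) / card R" by (simp add: norm_divide)
  also have "\<dots> \<le> (card R * \<epsilon>) / card R"
    using sum_norm_le[of R "\<lambda>k. c - f k" "\<lambda>_. \<epsilon>"] le n by (intro divide_right_mono) auto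
  also have "\<dots> = \<epsilon>" using n by simp
  finally show ?thesis .
qed

text \<open>\<open>approx\<close> extracts from Fell neighbourhoods the case of a single
  coefficient. Admissibility is asked of the approximating representation \<open>q\<close>, whose
  \<open>K\<close>-biinvariant coefficients must span a finite-dimensional space.\<close>

lemma rep_iso_of_approximation:
  fixes s :: "complex \<Rightarrow> 'v \<Rightarrow> 'v::ab_group_add" and t :: "complex \<Rightarrow> 'w \<Rightarrow> 'w::ab_group_add"
  assumes lc: "lc_group G T"
    and r: "smooth_rep G T s r" "irreducible_rep G s r"
    and q: "admissible_rep G T t q" "irreducible_rep G t q"
    and approx: "\<And>v \<xi> B \<epsilon>. v \<in> rep_space r \<Longrightarrow> \<xi> \<in> smooth_dual G T s r \<Longrightarrow> compactin T B \<Longrightarrow> 0 < \<epsilon> \<Longrightarrow>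
      \<exists>w \<zeta>. w \<in> rep_space q \<and> linear_on t (*) (rep_space q) \<zeta> \<and>
        (\<forall>g\<in>B. cmod (\<xi> (action r g v) - \<zeta> (action q g w)) < \<epsilon>)"
  shows "\<exists>\<phi>. rep_iso G t s q r \<phi>"
proof -
  have TG: "topological_group G T" using lc by (simp add: lc_group_def l_group_def)
  then have G: "group G" by (simp add: topological_group_def)
  interpret G: group G by (rule G)
  have rr: "representation G s r" using r(1) by (simp add: smooth_rep_def)
  have qs: "smooth_rep G T t q" using q(1) by (simp add: admissible_rep_def)
  have qq: "representation G t q" using qs by (simp add: smooth_rep_def)
  interpret R0: group_rep G s r by (rule group_repI[OF G rr])
  obtain v where v: "v \<in> rep_space r" "v \<noteq> 0"
    using r(2) R0.space(2) unfolding irreducible_rep_def by blast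
  obtain M0 where M0: "compact_open_subgroup G T M0"
    using lc G.one_closed unfolding lc_group_def by blast
  \<comment> \<open>Intersecting with the stabilizer of \<open>v\<close> makes \<open>v\<close> a
    \<open>K\<close>-fixed vector, while \<open>K\<close> stays compact and open.\<close>
  define K where "K = M0 \<inter> {g \<in> carrier G. action r g v = v}"
  have K: "compact_open_subgroup G T K"
    unfolding K_def using r(1) v(1)
    by (intro compact_open_subgroup_Int[OF TG M0] R0.stabilizer_subgroup) (auto simp: smooth_rep_def)
  then have Kco: "subgroup K G" "compactin T K" "openin T K" by (auto simp: compact_open_subgroup_def)
  interpret R: smooth_group_rep G s r T K
    by (intro smooth_group_rep.intro group_repI smooth_group_rep_axioms.intro G rr TG r(1) Kco)
  interpret Q: smooth_group_rep G t q T K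
    by (intro smooth_group_rep.intro group_repI smooth_group_rep_axioms.intro G qq TG qs Kco)
  have vK: "v \<in> fixed_vectors r K" using v(1) by (auto simp: fixed_vectors_def K_def)
  obtain \<xi> where \<xi>: "\<xi> \<in> smooth_dual G T s r" "\<xi> v = 1"
    "\<And>k x. k \<in> K \<Longrightarrow> x \<in> rep_space r \<Longrightarrow> \<xi> (action r k x) = \<xi> x"
    using R.invariant_functional_exists[OF Kco(3) vK v(2)] by metis
  have \<xi>_lin: "linear_on s (*) (rep_space r) \<xi>" using \<xi>(1) by (simp add: smooth_dual_def)
  obtain E where E: "linear_on t t (rep_space q) E" "\<And>x. x \<in> rep_space q \<Longrightarrow> E x \<in> fixed_vectors q K"
    "\<And>x. x \<in> rep_space q \<Longrightarrow>
      \<exists>R. finite R \<and> R \<noteq> {} \<and> R \<subseteq> K \<and> E x = t (1 / of_nat (card R)) (\<Sum>k\<in>R. action q k x)"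
    using Q.averaging_projection by metis
  obtain B0 where B0: "finite B0" "Q.S.span B0 = fixed_vectors q K"
    using q(1) K by (auto simp: admissible_rep_def finite_dimensional_def)
  \<comment> \<open>A finite basis of the \<open>K\<close>-fixed vectors is needed, not just a
    spanning set, so that the coordinates \<open>\<beta>\<close> are linear.\<close>
  obtain B where B: "B \<subseteq> B0" "Q.S.independent B" "B0 \<subseteq> Q.S.span B"
    by (rule Q.S.maximal_independent_subset)
  have fB: "finite B" using B(1) B0(1) by (rule finite_subset)
  have spanB: "Q.S.span B = fixed_vectors q K"
    using Q.S.span_mono[OF B(1)] Q.S.span_minimal[OF B(3) Q.S.subspace_span] B0(2) by blast
  have BX: "b \<in> rep_space q" if "b \<in> B" for b
    using Q.S.span_base[OF that] spanB Q.fixed_vectorsD(1) by blast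
  have EB: "E x \<in> Q.S.span B" if "x \<in> rep_space q" for x using E(2) that spanB by blast
  define \<beta> where "\<beta> b x = Q.S.representation B x b" for b x
  have \<beta>_sum: "(\<Sum>b\<in>B. t (\<beta> b x) b) = x" if "x \<in> Q.S.span B" for x
    unfolding \<beta>_def using Q.S.sum_representation_eq[OF B(2) that fB order_refl] .
  define c where "c g = \<xi> (action r g v)" for g
  \<comment> \<open>\<open>a (b, b')\<close> is a matrix entry, in the basis \<open>B\<close>, of
    the operator that acts by \<open>g\<close> on \<open>K\<close>-fixed vectors and then projects
    back by \<open>E\<close>.\<close>
  define a where "a i g = \<beta> (snd i) (E (action q g (fst i)))" for i g
  have "finite (B \<times> B)" using fB by simp
  from finite_family_separation[OF this, of "carrier G" c a] show ?thesis
  proof (elim disjE exE conjE)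
    fix l assume l: "\<forall>g\<in>carrier G. c g = (\<Sum>i\<in>B \<times> B. l i * a i g)"
    \<comment> \<open>Each term is a coefficient of \<open>q\<close> with vector
      \<open>fst i\<close> and functional \<open>l i\<close> times the coordinate
      \<open>snd i\<close> after \<open>E\<close>.\<close>
    show ?thesis
    proof (rule rep_iso_of_coefficients[OF G r(2) q(2) \<xi>_lin v(1) _ \<open>finite (B \<times> B)\<close> _ v])
      show "\<xi> v \<noteq> 0" using \<xi>(2) by simp
      show "linear_on t (*) (rep_space q) (\<lambda>x. l i * \<beta> (snd i) (E x))" for i
        using E(1) EB
        by (simp add: linear_on_def \<beta>_def Q.S.representation_add[OF B(2)]
            Q.S.representation_scale[OF B(2)] algebra_simps)
      show "fst i \<in> rep_space q" if "i \<in> B \<times> B" for i using that BX by auto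
      show "\<xi> (action r g v) = (\<Sum>i\<in>B \<times> B. l i * \<beta> (snd i) (E (action q g (fst i))))"
        if "g \<in> carrier G" for g
        using l that by (simp add: a_def c_def)
    qed
  next
    fix F \<mu> assume F: "finite F" "F \<subseteq> carrier G" "\<forall>i\<in>B \<times> B. (\<Sum>g\<in>F. \<mu> g * a i g) = 0"
      "(\<Sum>g\<in>F. \<mu> g * c g) = 1"
    obtain M where M: "compact_open_subgroup G T M" "K \<subseteq> M" "F \<subseteq> M"
      using lc_group_finite_subset[OF lc K F(1,2)] by blast
    have Mco: "subgroup M G" "compactin T M" using M(1) by (auto simp: compact_open_subgroup_def)
    \<comment> \<open>\<open>N\<close> is the total mass of the measure; with
      \<open>\<epsilon> = 1 / (1 + N)\<close> an error of at most \<open>\<epsilon>\<close> at each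
      point changes its integral by less than 1.\<close>
    define N where "N = (\<Sum>g\<in>F. cmod (\<mu> g))"
    define \<epsilon> where "\<epsilon> = 1 / (1 + N)"
    have N: "N \<ge> 0" unfolding N_def by (rule sum_nonneg) simp
    then have "\<epsilon> > 0" by (simp add: \<epsilon>_def)
    then obtain w \<zeta> where w: "w \<in> rep_space q" and \<zeta>: "linear_on t (*) (rep_space q) \<zeta>"
      and close: "\<And>g. g \<in> M \<Longrightarrow> cmod (c g - \<zeta> (action q g w)) < \<epsilon>"
      using approx[OF v(1) \<xi>(1) Mco(2)] unfolding c_def by blast
    have Mc: "g \<in> carrier G" if "g \<in> M" for g using subgroup.mem_carrier[OF Mco(1) that] .
    have Kc: "k \<in> carrier G" if "k \<in> K" for k using Mc M(2) that by blast
    have E_space: "E x \<in> rep_space q" if "x \<in> rep_space q" for x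
      using E(2)[OF that] Q.fixed_vectorsD(1) by blast
    define e where "e = E w"
    have e: "e \<in> rep_space q" unfolding e_def by (rule E_space[OF w])
    \<comment> \<open>Averaging on the right: \<open>c\<close> is right \<open>K\<close>-invariant
      because \<open>v\<close> is fixed, and \<open>M\<close> contains the products of
      \<open>h\<close> with \<open>K\<close>. So all values being averaged are within
      \<open>\<epsilon>\<close> of the same number.\<close>
    have close1: "cmod (c h - \<zeta> (action q h e)) \<le> \<epsilon>" if h: "h \<in> M" for h
    proof -
      obtain R where R: "finite R" "R \<noteq> {}" "R \<subseteq> K" "e = t (1 / of_nat (card R)) (\<Sum>k\<in>R. action q k w)"
        using E(3)[OF w] unfolding e_def by blast
      have "linear_on t (*) (rep_space q) (\<lambda>x. \<zeta> (action q h x))"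
        using \<zeta> Q.act(1)[OF Mc[OF h]] Q.act_add[OF Mc[OF h]] Q.act_scale[OF Mc[OF h]]
        by (simp add: linear_on_def)
      then have "\<zeta> (action q h e) = 1 / of_nat (card R) * (\<Sum>k\<in>R. \<zeta> (action q h (action q k w)))"
        unfolding R(4) using Q.functional_average[of "\<lambda>x. \<zeta> (action q h x)" R w] R(3) Kc w by blast
      moreover have "cmod (c h - \<zeta> (action q h (action q k w))) \<le> \<epsilon>" if k: "k \<in> R" for k
      proof -
        have k': "k \<in> K" "k \<in> carrier G" using R(3) Kc k by auto
        have "h \<otimes>\<^bsub>G\<^esub> k \<in> M" using h k' M(2) subgroup.m_closed[OF Mco(1)] by blast
        moreover have "c (h \<otimes>\<^bsub>G\<^esub> k) = c h"
          using R0.act(4)[OF Mc[OF h] k'(2) v(1)] R0.fixed_vectorsD(2)[OF vK k'(1)] by (simp add: c_def)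
        ultimately show ?thesis
          using close[of "h \<otimes>\<^bsub>G\<^esub> k"] Q.act(4)[OF Mc[OF h] k'(2) w] by simp
      qed
      ultimately show ?thesis using average_close[OF R(1,2)] by metis
    qed
    \<comment> \<open>Averaging on the left: here \<open>c\<close> is left
      \<open>K\<close>-invariant because \<open>\<xi>\<close> is, and composing with
      \<open>E\<close> replaces \<open>\<zeta>\<close> by its average over \<open>K\<close>.\<close>
    have close2: "cmod (c g - \<zeta> (E (action q g e))) \<le> \<epsilon>" if g: "g \<in> M" for g
    proof -
      have ge: "action q g e \<in> rep_space q" using Q.act(1) Mc g e by blast
      obtain R where R: "finite R" "R \<noteq> {}" "R \<subseteq> K"
        "E (action q g e) = t (1 / of_nat (card R)) (\<Sum>k\<in>R. action q k (action q g e))"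
        using E(3)[OF ge] by blast
      have "\<zeta> (E (action q g e)) = 1 / of_nat (card R) * (\<Sum>k\<in>R. \<zeta> (action q k (action q g e)))"
        unfolding R(4) using Q.functional_average[OF \<zeta> _ ge, of R] R(3) Kc by blast
      moreover have "cmod (c g - \<zeta> (action q k (action q g e))) \<le> \<epsilon>" if k: "k \<in> R" for k
      proof -
        have k': "k \<in> K" "k \<in> carrier G" using R(3) Kc k by auto
        have "k \<otimes>\<^bsub>G\<^esub> g \<in> M" using g k' M(2) subgroup.m_closed[OF Mco(1)] by blast
        moreover have "c (k \<otimes>\<^bsub>G\<^esub> g) = c g"
          using R0.act(4)[OF k'(2) Mc[OF g] v(1)] \<xi>(3)[OF k'(1) R0.act(1)[OF Mc[OF g] v(1)]] by (simp add: c_def)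
        ultimately show ?thesis
          using close1[of "k \<otimes>\<^bsub>G\<^esub> g"] Q.act(4)[OF k'(2) Mc[OF g] e] by simp
      qed
      ultimately show ?thesis using average_close[OF R(1,2)] by metis
    qed
    \<comment> \<open>Expanding first \<open>e\<close> and then the projected translate of each
      basis vector in \<open>B\<close> leaves all dependence on \<open>g\<close> in the functions
      \<open>a i\<close>, which the measure kills.\<close>
    have expand: "\<zeta> (E (action q g e)) = (\<Sum>i\<in>B \<times> B. \<beta> (fst i) e * \<zeta> (snd i) * a i g)"
      if g: "g \<in> carrier G" for g
    proof -
      have lin: "linear_on t (*) (rep_space q) (\<lambda>x. \<zeta> (E (action q g x)))"
        using \<zeta> E(1) E_space Q.act(1)[OF g] Q.act_add[OF g] Q.act_scale[OF g] by (simp add: linear_on_def)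
      have coeff: "\<zeta> (E (action q g b)) = (\<Sum>b'\<in>B. a (b, b') g * \<zeta> b')" if b: "b \<in> B" for b
      proof -
        have "\<zeta> (E (action q g b)) = \<zeta> (\<Sum>b'\<in>B. t (a (b, b') g) b')"
          using \<beta>_sum[OF EB[OF Q.act(1)[OF g BX[OF b]]]] by (simp add: a_def)
        also have "\<dots> = (\<Sum>b'\<in>B. \<zeta> (t (a (b, b') g) b'))"
          using BX Q.space(4) by (intro Q.linear_on_sum[OF \<zeta>]) auto
        also have "\<dots> = (\<Sum>b'\<in>B. a (b, b') g * \<zeta> b')"
          using \<zeta> BX by (intro sum.cong refl) (simp add: linear_on_def)
        finally show ?thesis .
      qed
      have "\<zeta> (E (action q g e)) = \<zeta> (E (action q g (\<Sum>b\<in>B. t (\<beta> b e) b)))"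
        using \<beta>_sum[of e] EB[OF w] by (simp add: e_def)
      also have "\<dots> = (\<Sum>b\<in>B. \<zeta> (E (action q g (t (\<beta> b e) b))))"
        using BX Q.space(4) by (intro Q.linear_on_sum[OF lin]) auto
      also have "\<dots> = (\<Sum>b\<in>B. \<beta> b e * (\<Sum>b'\<in>B. a (b, b') g * \<zeta> b'))"
        using lin BX coeff by (intro sum.cong refl) (simp add: linear_on_def)
      also have "\<dots> = (\<Sum>b\<in>B. \<Sum>b'\<in>B. \<beta> b e * \<zeta> b' * a (b, b') g)"
        by (simp add: sum_distrib_left mult_ac)
      also have "\<dots> = (\<Sum>i\<in>B \<times> B. \<beta> (fst i) e * \<zeta> (snd i) * a i g)"
        by (simp add: sum.cartesian_product case_prod_unfold)
      finally show ?thesis .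
    qed
    have "(\<Sum>g\<in>F. \<mu> g * \<zeta> (E (action q g e))) =
        (\<Sum>g\<in>F. \<Sum>i\<in>B \<times> B. \<beta> (fst i) e * \<zeta> (snd i) * (\<mu> g * a i g))"
      using expand F(2) by (intro sum.cong refl) (auto simp: sum_distrib_left mult_ac subset_iff)
    also have "\<dots> = (\<Sum>i\<in>B \<times> B. \<beta> (fst i) e * \<zeta> (snd i) * (\<Sum>g\<in>F. \<mu> g * a i g))"
      unfolding sum_distrib_left by (rule sum.swap)
    also have "\<dots> = 0" using F(3) by (simp only: mult_zero_right sum.neutral_const cong: sum.cong)
    finally have "1 = (\<Sum>g\<in>F. \<mu> g * (c g - \<zeta> (E (action q g e))))"
      using F(4) by (simp add: right_diff_distrib sum_subtractf)
    then have "1 = cmod (\<Sum>g\<in>F. \<mu> g * (c g - \<zeta> (E (action q g e))))" by (metis norm_one)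
    \<comment> \<open>The measure sends \<open>c\<close> to 1 and the approximating coefficient to
      0, yet the two differ by at most \<open>\<epsilon>\<close> on its support.\<close>
    also have "\<dots> \<le> (\<Sum>g\<in>F. cmod (\<mu> g) * \<epsilon>)"
      using close2 M(3) by (intro sum_norm_le) (auto simp: norm_mult intro!: mult_left_mono)
    also have "\<dots> = N / (1 + N)" by (simp add: N_def \<epsilon>_def sum_divide_distrib)
    also have "\<dots> < 1" using N by simp
    finally show ?thesis by simp
  qed
qed

section \<open>Separation of points in the Fell topology\<close>

theorem corollary1p8p1:
  fixes G :: "('a, 'b) monoid_scheme" and T :: "'a topology"
  assumes "lc_group G T" and "tame G T"
  shows "t1_space (fell_topology G T)"
  unfolding t1_space_def topspace_fell_topology
proof (intro ballI impI)
  fix x y assume x: "x \<in> smooth_irr_classes G T" and y: "y \<in> smooth_irr_classes G T" and "x \<noteq> y"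
  have TG: "topological_group G T" using assms(1) by (simp add: lc_group_def l_group_def)
  then have G: "group G" by (simp add: topological_group_def)
  obtain r where r: "r \<in> irreps G T" "x = iso_rel G T `` {r}"
    using x unfolding smooth_irr_classes_def by (rule quotientE)
  obtain q where q: "q \<in> irreps G T" "y = iso_rel G T `` {q}"
    using y unfolding smooth_irr_classes_def by (rule quotientE)
  have rx: "r \<in> x" using equiv_class_self[OF equiv_iso_rel r(1)] r(2) by simp
  show "\<exists>U. openin (fell_topology G T) U \<and> x \<in> U \<and> y \<notin> U"
  proof (rule ccontr)
    assume no: "\<nexists>U. openin (fell_topology G T) U \<and> x \<in> U \<and> y \<notin> U"
    have "\<exists>\<phi>. rep_iso G fun_scale fun_scale q r \<phi>"
    proof (rule rep_iso_of_approximation[OF assms(1)])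
      show "smooth_rep G T fun_scale r" "irreducible_rep G fun_scale r" "irreducible_rep G fun_scale q"
        using r(1) q(1) by (auto simp: irreps_def)
      show "admissible_rep G T fun_scale q" using assms(2) q(1) by (simp add: tame_def)
      fix v \<xi> B and \<epsilon> :: real
      assume v: "v \<in> rep_space r" "\<xi> \<in> smooth_dual G T fun_scale r" and B: "compactin T B" and \<epsilon>: "0 < \<epsilon>"
      \<comment> \<open>A neighbourhood given by one coefficient is enough; being open, it must
        contain \<open>y\<close> by \<open>no\<close>.\<close>
      let ?U = "fell_nbhd G T r 1 (\<lambda>_. v) (\<lambda>_. \<xi>) B \<epsilon>"
      have d: "fell_data G T r 1 (\<lambda>_. v) (\<lambda>_. \<xi>)" using v by (simp add: fell_data_def)
      have "y \<in> ?U"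
        using no openin_fell_nbhd[OF TG r(1) d B \<epsilon>] fell_nbhd_self[OF x rx d \<epsilon>] by blast
      \<comment> \<open>Membership of the class \<open>y\<close> only provides some representative
        \<open>p\<close>; its vector and functional are carried to the fixed representative
        \<open>q\<close> along an isomorphism.\<close>
      then obtain p w \<zeta> where p: "p \<in> y" "fell_data G T p 1 w \<zeta>"
        and lt: "\<forall>j<1. \<forall>g\<in>B. cmod (\<xi> (action r g v) - \<zeta> j (action p g (w j))) < \<epsilon>"
        unfolding fell_nbhd_def by blast
      have "(p, q) \<in> iso_rel G T"
        using p(1) equiv_iso_rel unfolding q(2) equiv_def by (auto dest: symD)
      then obtain \<phi> where p': "p \<in> irreps G T" and \<phi>: "rep_iso G fun_scale fun_scale p q \<phi>"
        by (auto simp: iso_rel_def)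
      note tr = fell_data_transport[OF p' p(2) \<phi> G]
      have BG: "B \<subseteq> carrier G"
        using compactin_subset_topspace[OF B] TG by (simp add: topological_group_def)
      let ?\<zeta> = "\<zeta> 0 \<circ> inv_into (rep_space p) \<phi>"
      have "\<phi> (w 0) \<in> rep_space q" "linear_on fun_scale (*) (rep_space q) ?\<zeta>"
        using tr(1) by (auto simp: fell_data_def smooth_dual_def)
      moreover have "\<forall>g\<in>B. cmod (\<xi> (action r g v) - ?\<zeta> (action q g (\<phi> (w 0)))) < \<epsilon>"
        using lt tr(2)[of 0] BG by (simp add: subset_iff)
      ultimately show "\<exists>w \<zeta>. w \<in> rep_space q \<and> linear_on fun_scale (*) (rep_space q) \<zeta> \<and>
          (\<forall>g\<in>B. cmod (\<xi> (action r g v) - \<zeta> (action q g w)) < \<epsilon>)"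
        by blast
    qed
    then have "(q, r) \<in> iso_rel G T" using r(1) q(1) by (simp add: iso_rel_def)
    then have "x = y" using equiv_class_eq[OF equiv_iso_rel] r(2) q(2) by metis
    then show False using \<open>x \<noteq> y\<close> by simp
  qed
qed

end
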